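(* Let $\beta>\alpha>2$ be real numbers and let $E$ be the lowest eigenvalue of the self-adjoint operator $Q(\alpha,\beta)$ on $\mathbb{C}^2\otimes L^2(\mathbb{R})$. Suppose that $$\frac12>\left(\frac12\beta-E\right)^{-2}\frac{1}{\alpha^2-1}+\frac{1}{\alpha^2-1}.$$ Then $E$ is a simple eigenvalue of $Q(\alpha,\beta)$, i.e. $\dim\operatorname{Ker}(Q(\alpha,\beta)-E)=1$.
   Context: For $\alpha,\beta>0$ with $\alpha\beta>1$, the non-commutative harmonic oscillator is the operator $$Q(\alpha,\beta)=A\otimes\left(-\frac12\frac{d^2}{dx^2}+\frac12x^2\right)+J\otimes\left(x\frac{d}{dx}+\frac12\right),\quad A=\begin{pmatrix}\alpha&0\\0&\beta\end{pmatrix},\quad J=\begin{pmatrix}0&-1\\1&0\end{pmatrix},$$ acting in the Hilbert space $\mathbb{C}^2\otimes L^2(\mathbb{R})$. It defines a positive self-adjoint operator with purely discrete spectrum $\lambda_1\le\lambda_2\le\cdots\uparrow\infty$ (eigenvalues counted with multiplicity). $E=\lambda_1$ is the lowest eigenvalue. *)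

theory Defs
  imports "HOL-Probability.Probability"
begin

section \<open>The Hilbert space \<open>\<complex>\<^sup>2 \<otimes> L\<^sup>2(\<real>)\<close>\<close>

text \<open>
  \<open>\<complex>\<^sup>2 \<otimes> L\<^sup>2(\<real>)\<close> is realised as \<open>L\<^sup>2(\<real>; \<complex>\<^sup>2)\<close>: square-integrable functions from
  the reals to \<open>\<complex>\<^sup>2\<close>, modulo equality almost everywhere.
\<close>

definition square_integrable :: "(real \<Rightarrow> complex^2) \<Rightarrow> bool" where
  "square_integrable f \<longleftrightarrow>
     f \<in> borel_measurable lborel \<and> integrable lborel (\<lambda>x. (norm (f x))\<^sup>2)"

definition l2_eq :: "(real \<Rightarrow> complex^2) \<Rightarrow> (real \<Rightarrow> complex^2) \<Rightarrow> bool" where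
  "l2_eq f g \<longleftrightarrow> square_integrable f \<and> square_integrable g \<and> (AE x in lborel. f x = g x)"

lemma square_integrable_zero: "square_integrable (\<lambda>x. 0)"
  by (simp add: square_integrable_def)

lemma square_integrable_inner:
  assumes "square_integrable f" "square_integrable g"
  shows "integrable lborel (\<lambda>x. f x \<bullet> g x)"
proof (rule Bochner_Integration.integrable_bound)
  show "integrable lborel (\<lambda>x. (norm (f x))\<^sup>2 + (norm (g x))\<^sup>2)"
    using assms by (auto simp: square_integrable_def)
  show "(\<lambda>x. f x \<bullet> g x) \<in> borel_measurable lborel"
    using assms by (auto simp: square_integrable_def)
  have "\<bar>f x \<bullet> g x\<bar> \<le> (norm (f x))\<^sup>2 + (norm (g x))\<^sup>2" for x
  proof -
    have "\<bar>f x \<bullet> g x\<bar> \<le> norm (f x) * norm (g x)" by (rule Cauchy_Schwarz_ineq2)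
    also have "\<dots> \<le> (norm (f x))\<^sup>2 + (norm (g x))\<^sup>2"
      using sum_squares_bound[of "norm (f x)" "norm (g x)"]
        mult_nonneg_nonneg[OF norm_ge_zero[of "f x"] norm_ge_zero[of "g x"]] by linarith
    finally show ?thesis .
  qed
  then show "AE x in lborel. norm (f x \<bullet> g x) \<le> norm ((norm (f x))\<^sup>2 + (norm (g x))\<^sup>2)"
    by auto
qed

lemma square_integrable_add:
  assumes "square_integrable f" "square_integrable g"
  shows "square_integrable (\<lambda>x. f x + g x)"
proof -
  have "(norm (f x + g x))\<^sup>2 = (norm (f x))\<^sup>2 + 2 * (f x \<bullet> g x) + (norm (g x))\<^sup>2" for x
    by (simp add: power2_norm_eq_inner inner_add_left inner_add_right inner_commute)
  then show ?thesis
    using assms square_integrable_inner[OF assms] by (auto simp: square_integrable_def)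
qed

lemma norm_vector_smult: "norm (c *s v) = norm c * norm (v :: complex^2)"
  by (simp add: norm_vec_def L2_set_def norm_mult power_mult_distrib real_sqrt_mult
      flip: sum_distrib_left)

lemma scaleR_eq_vector_smult: "r *\<^sub>R (v :: complex^2) = complex_of_real r *s v"
  unfolding vec_eq_iff vector_smult_component vector_scaleR_component
  by (simp add: scaleR_conv_of_real)

lemma linear_vector_smult: "linear (\<lambda>v::complex^2. c *s v)"
  by (rule linearI) (simp_all add: vec_eq_iff algebra_simps)

lemma borel_measurable_vector_smult [measurable]:
  "f \<in> borel_measurable M \<Longrightarrow> (\<lambda>x. c *s f x :: complex^2) \<in> borel_measurable M"
  by (rule borel_measurable_continuous_on
      [OF linear_continuous_on[OF linear_linear[THEN iffD2, OF linear_vector_smult]]])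

lemma square_integrable_smult:
  "square_integrable f \<Longrightarrow> square_integrable (\<lambda>x. c *s f x)"
  by (auto simp: square_integrable_def norm_vector_smult power_mult_distrib)

lemma square_integrable_scaleR:
  "square_integrable f \<Longrightarrow> square_integrable (\<lambda>x. r *\<^sub>R f x)"
  using square_integrable_smult[of f "complex_of_real r"] by (simp add: scaleR_eq_vector_smult)

lemma square_integrable_uminus:
  "square_integrable f \<Longrightarrow> square_integrable (\<lambda>x. - f x)"
  using square_integrable_scaleR[of f "-1"] by simp

lemma square_integrable_diff:
  "square_integrable f \<Longrightarrow> square_integrable g \<Longrightarrow> square_integrable (\<lambda>x. f x - g x)"
  using square_integrable_add[OF _ square_integrable_uminus, of f g] by simp

quotient_type l2 = "real \<Rightarrow> complex^2" / partial: l2_eq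
  morphisms rep_l2 abs_l2
proof (rule part_equivpI)
  show "\<exists>f. l2_eq f f"
    using square_integrable_zero by (auto simp: l2_eq_def)
  show "symp l2_eq"
    by (auto simp: symp_def l2_eq_def)
  show "transp l2_eq"
    unfolding transp_def l2_eq_def by (auto elim: AE_mp)
qed

instantiation l2 :: real_vector
begin

lift_definition zero_l2 :: l2 is "\<lambda>x. 0"
  by (simp add: l2_eq_def square_integrable_zero)

lift_definition plus_l2 :: "l2 \<Rightarrow> l2 \<Rightarrow> l2" is "\<lambda>f g x. f x + g x"
  by (auto simp: l2_eq_def square_integrable_add)

lift_definition minus_l2 :: "l2 \<Rightarrow> l2 \<Rightarrow> l2" is "\<lambda>f g x. f x - g x"
  by (auto simp: l2_eq_def square_integrable_diff)

lift_definition uminus_l2 :: "l2 \<Rightarrow> l2" is "\<lambda>f x. - f x"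
  by (auto simp: l2_eq_def square_integrable_uminus)

lift_definition scaleR_l2 :: "real \<Rightarrow> l2 \<Rightarrow> l2" is "\<lambda>r f x. r *\<^sub>R f x"
  by (auto simp: l2_eq_def square_integrable_scaleR)

instance
  by standard
    (transfer; auto simp: l2_eq_def algebra_simps square_integrable_zero
      intro!: square_integrable_add square_integrable_diff square_integrable_uminus
        square_integrable_scaleR)+

end

text \<open>
  The real inner product is the real part of the Hermitian one; it induces the usual norm
  \<open>\<parallel>f\<parallel>\<^sup>2 = \<integral> |f(x)|\<^sup>2 dx\<close>.
\<close>

instantiation l2 :: real_inner
begin

lift_definition inner_l2 :: "l2 \<Rightarrow> l2 \<Rightarrow> real" is
  "\<lambda>f g. \<integral>x. f x \<bullet> g x \<partial>lborel"
  by (rule integral_cong_AE) (auto simp: l2_eq_def square_integrable_def)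

definition norm_l2 :: "l2 \<Rightarrow> real" where "norm_l2 f = sqrt (f \<bullet> f)"

definition dist_l2 :: "l2 \<Rightarrow> l2 \<Rightarrow> real" where "dist_l2 f g = norm (f - g)"

definition sgn_l2 :: "l2 \<Rightarrow> l2" where "sgn_l2 f = f /\<^sub>R norm f"

definition uniformity_l2 :: "(l2 \<times> l2) filter" where
  "uniformity_l2 = (INF e\<in>{0<..}. principal {(f, g). dist f g < e})"

definition open_l2 :: "l2 set \<Rightarrow> bool" where
  "open_l2 U \<longleftrightarrow> (\<forall>f\<in>U. \<forall>\<^sub>F (f', g) in uniformity. f' = f \<longrightarrow> g \<in> U)"

instance
proof
  fix f g h :: l2 and r :: real and U :: "l2 set"
  show "dist f g = norm (f - g)" by (rule dist_l2_def)
  show "sgn f = f /\<^sub>R norm f" by (rule sgn_l2_def)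
  show "norm f = sqrt (f \<bullet> f)" by (rule norm_l2_def)
  show "(uniformity :: (l2 \<times> l2) filter) = (INF e\<in>{0<..}. principal {(f, g). dist f g < e})"
    by (rule uniformity_l2_def)
  show "open U \<longleftrightarrow> (\<forall>f\<in>U. \<forall>\<^sub>F (f', g) in uniformity. f' = f \<longrightarrow> g \<in> U)"
    by (rule open_l2_def)
  show "f \<bullet> g = g \<bullet> f"
    by transfer (simp add: inner_commute)
  show "(f + g) \<bullet> h = f \<bullet> h + g \<bullet> h"
    by transfer (simp add: l2_eq_def inner_add_left square_integrable_inner)
  show "(r *\<^sub>R f) \<bullet> g = r * (f \<bullet> g)"
    by transfer simp
  show "0 \<le> f \<bullet> f"
    by transfer simp
  show "f \<bullet> f = 0 \<longleftrightarrow> f = 0"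
  proof (transfer)
    fix f :: "real \<Rightarrow> complex^2"
    assume "l2_eq f f"
    then have f: "square_integrable f" by (simp add: l2_eq_def)
    have "(\<integral>x. f x \<bullet> f x \<partial>lborel) = 0 \<longleftrightarrow> (AE x in lborel. f x \<bullet> f x = 0)"
      by (rule integral_nonneg_eq_0_iff_AE) (auto intro: square_integrable_inner f)
    then show "(\<integral>x. f x \<bullet> f x \<partial>lborel) = 0 \<longleftrightarrow> l2_eq f (\<lambda>x. 0)"
      using f by (simp add: l2_eq_def square_integrable_zero)
  qed
qed

end

lift_definition scaleC :: "complex \<Rightarrow> l2 \<Rightarrow> l2" is "\<lambda>c f x. c *s f x"
  by (auto simp: l2_eq_def square_integrable_smult)

interpretation l2: vector_space scaleC
  by unfold_locales
    (transfer; auto simp: l2_eq_def vec_eq_iff algebra_simps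
      intro!: square_integrable_add square_integrable_smult)+

section \<open>Unbounded operators\<close>

text \<open>
  A linear operator in the Hilbert space, with its domain, is represented by its graph; closing
  an operator is taking the topological closure of the graph in the product space.
\<close>

definition ker_minus :: "(l2 \<times> l2) set \<Rightarrow> complex \<Rightarrow> l2 set" where
  "ker_minus T c = {u. (u, scaleC c u) \<in> T}"

definition eigenvalue :: "(l2 \<times> l2) set \<Rightarrow> complex \<Rightarrow> bool" where
  "eigenvalue T c \<longleftrightarrow> (\<exists>u\<in>ker_minus T c. u \<noteq> 0)"

definition lowest_eigenvalue :: "(l2 \<times> l2) set \<Rightarrow> real \<Rightarrow> bool" where
  "lowest_eigenvalue T E \<longleftrightarrow>
     eigenvalue T (of_real E) \<and> (\<forall>\<mu>::real. eigenvalue T (of_real \<mu>) \<longrightarrow> E \<le> \<mu>)"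

section \<open>The non-commutative harmonic oscillator\<close>

text \<open>Here \<open>D n\<close> is the \<open>n\<close>-th derivative of \<open>\<phi>\<close>.\<close>

definition schwartz :: "(real \<Rightarrow> complex^2) \<Rightarrow> bool" where
  "schwartz \<phi> \<longleftrightarrow>
     (\<exists>D :: nat \<Rightarrow> real \<Rightarrow> complex^2. D 0 = \<phi> \<and>
        (\<forall>n x. (D n has_vector_derivative D (Suc n) x) (at x)) \<and>
        (\<forall>m n. bounded (range (\<lambda>x. x ^ m *\<^sub>R D n x))))"

definition matA :: "real \<Rightarrow> real \<Rightarrow> complex^2^2" where
  "matA \<alpha> \<beta> = vector [vector [of_real \<alpha>, 0], vector [0, of_real \<beta>]]"

definition matJ :: "complex^2^2" where
  "matJ = vector [vector [0, -1], vector [1, 0]]"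

definition vderiv :: "(real \<Rightarrow> complex^2) \<Rightarrow> real \<Rightarrow> complex^2" where
  "vderiv \<phi> x = vector_derivative \<phi> (at x)"

definition ncho_expr :: "real \<Rightarrow> real \<Rightarrow> (real \<Rightarrow> complex^2) \<Rightarrow> real \<Rightarrow> complex^2" where
  "ncho_expr \<alpha> \<beta> \<phi> x =
     matA \<alpha> \<beta> *v (- (1/2) *\<^sub>R vderiv (vderiv \<phi>) x + (1/2 * x\<^sup>2) *\<^sub>R \<phi> x)
     + matJ *v (x *\<^sub>R vderiv \<phi> x + (1/2) *\<^sub>R \<phi> x)"

text \<open>
  For \<open>\<alpha>, \<beta> > 0\<close> with \<open>\<alpha> \<beta> > 1\<close> the differential expression is essentially self-adjoint on
  the Schwartz space, so the self-adjoint operator it defines is the closure of its restriction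
  to Schwartz functions.
\<close>

definition ncho :: "real \<Rightarrow> real \<Rightarrow> (l2 \<times> l2) set" where
  "ncho \<alpha> \<beta> = closure {(abs_l2 \<phi>, abs_l2 (ncho_expr \<alpha> \<beta> \<phi>)) |\<phi>. schwartz \<phi>}"

text \<open>
  The next lemmas show that \<^const>\<open>abs_l2\<close> is applied only to square-integrable functions in
  \<^const>\<open>ncho\<close>.
\<close>

lemma square_integrable_of_decay:
  assumes cont: "continuous_on UNIV f"
    and b0: "bounded (range f)" and b1: "bounded (range (\<lambda>x. x *\<^sub>R f x))"
  shows "square_integrable f"
proof -
  obtain B where B: "\<And>x. norm (f x) \<le> B" using b0 by (auto simp: bounded_iff)
  obtain C where C: "\<And>x. norm (x *\<^sub>R f x) \<le> C" using b1 by (auto simp: bounded_iff)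
  have meas [measurable]: "f \<in> borel_measurable borel"
    by (rule borel_measurable_continuous_onI[OF cont])
  have le: "(norm (f x))\<^sup>2 \<le> (B\<^sup>2 + C\<^sup>2) * inverse (1 + x\<^sup>2)" for x
  proof -
    have "(norm (f x))\<^sup>2 \<le> B\<^sup>2" by (intro power_mono B) simp
    moreover have "(norm (x *\<^sub>R f x))\<^sup>2 \<le> C\<^sup>2" by (intro power_mono C) simp
    ultimately have "(norm (f x))\<^sup>2 * (1 + x\<^sup>2) \<le> B\<^sup>2 + C\<^sup>2"
      by (simp add: power_mult_distrib algebra_simps)
    moreover have "1 + x\<^sup>2 > 0" by (simp add: add_pos_nonneg)
    ultimately show ?thesis by (simp add: field_simps)
  qed
  have "integrable lborel (\<lambda>x::real. inverse (1 + x\<^sup>2))"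
    using integrable_I0i_1_div_plus_square LBINT_I0i_1_div_plus_square integrable_inverse_1_plus_square
    by (simp add: set_integrable_def)
  then have "integrable lborel (\<lambda>x. (B\<^sup>2 + C\<^sup>2) * inverse (1 + x\<^sup>2))" by simp
  then have "integrable lborel (\<lambda>x. (norm (f x))\<^sup>2)"
    by (rule Bochner_Integration.integrable_bound) (use le in \<open>auto intro!: AE_I2 simp: order_trans[OF le]\<close>)
  then show ?thesis by (simp add: square_integrable_def)
qed

lemma square_integrable_matrix:
  fixes M :: "complex^2^2"
  assumes "square_integrable f"
  shows "square_integrable (\<lambda>x. M *v f x)"
proof -
  have lin: "linear (\<lambda>v. M *v v)"
    by (rule linearI) (simp_all add: vec_eq_iff matrix_vector_mult_def forall_2 sum_2 algebra_simps)
  then obtain K where K: "\<And>v. norm (M *v v) \<le> norm v * K"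
    using bounded_linear.bounded[OF linear_conv_bounded_linear[THEN iffD1, OF lin]] by blast
  have m: "(\<lambda>x. M *v f x) \<in> borel_measurable lborel"
    by (rule borel_measurable_continuous_on[OF linear_continuous_on])
      (use assms lin in \<open>auto simp: square_integrable_def linear_conv_bounded_linear\<close>)
  have le: "(norm (M *v f x))\<^sup>2 \<le> K\<^sup>2 * (norm (f x))\<^sup>2" for x
    using power_mono[OF K[of "f x"] norm_ge_zero, of 2] by (simp add: power_mult_distrib mult.commute)
  have "integrable lborel (\<lambda>x. K\<^sup>2 * (norm (f x))\<^sup>2)"
    using assms by (simp add: square_integrable_def)
  then have "integrable lborel (\<lambda>x. (norm (M *v f x))\<^sup>2)"
    by (rule Bochner_Integration.integrable_bound) (use le m in \<open>auto intro!: AE_I2\<close>)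
  with m show ?thesis by (simp add: square_integrable_def)
qed

lemma square_integrable_schwartz:
  assumes "schwartz \<phi>"
  shows "square_integrable \<phi>" and "square_integrable (ncho_expr \<alpha> \<beta> \<phi>)"
proof -
  obtain D where D0: "D 0 = \<phi>"
    and D: "\<And>n x. (D n has_vector_derivative D (Suc n) x) (at x)"
    and bd: "\<And>m n. bounded (range (\<lambda>x. x ^ m *\<^sub>R D n x))"
    using assms by (auto simp: schwartz_def)
  have cont: "continuous_on UNIV (D n)" for n
    by (meson D continuous_at_imp_continuous_on has_vector_derivative_continuous)
  have sq: "square_integrable (\<lambda>x. x ^ m *\<^sub>R D n x)" for m n
    using bd[of m n] bd[of "Suc m" n]
    by (intro square_integrable_of_decay continuous_intros cont) simp_all
  show "square_integrable \<phi>" using sq[of 0 0] by (simp add: D0)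
  have d: "vderiv (D n) = D (Suc n)" for n
    by (rule ext) (simp add: vderiv_def vector_derivative_at[OF D])
  have "square_integrable (\<lambda>x.
     matA \<alpha> \<beta> *v (- (1/2) *\<^sub>R (x^0 *\<^sub>R D 2 x) + (1/2) *\<^sub>R (x\<^sup>2 *\<^sub>R D 0 x))
     + matJ *v (x^1 *\<^sub>R D 1 x + (1/2) *\<^sub>R (x^0 *\<^sub>R D 0 x)))"
    by (intro square_integrable_add square_integrable_matrix square_integrable_scaleR sq)
  moreover have "ncho_expr \<alpha> \<beta> \<phi> = (\<lambda>x.
     matA \<alpha> \<beta> *v (- (1/2) *\<^sub>R (x^0 *\<^sub>R D 2 x) + (1/2) *\<^sub>R (x\<^sup>2 *\<^sub>R D 0 x))
     + matJ *v (x^1 *\<^sub>R D 1 x + (1/2) *\<^sub>R (x^0 *\<^sub>R D 0 x)))"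
    by (rule ext) (simp add: ncho_expr_def d numeral_2_eq_2 flip: D0)
  ultimately show "square_integrable (ncho_expr \<alpha> \<beta> \<phi>)" by simp
qed

end

theory Submission
  imports Defs "HOL-Computational_Algebra.Polynomial" "HOL-Real_Asymp.Real_Asymp"
begin

text \<open>
  In the Hermite basis the eigenvalue equation of \<open>Q(\<alpha>,\<beta>)\<close> splits into four three-term recurrences
  for the coefficients \<open>(f\<^sub>n, g\<^sub>n)\<close>, along the chains \<open>f\<^sub>0, g\<^sub>2, f\<^sub>4, \<dots>\<close>, \<open>g\<^sub>0, f\<^sub>2, g\<^sub>4, \<dots>\<close>,
  \<open>f\<^sub>1, g\<^sub>3, \<dots>\<close> and \<open>g\<^sub>1, f\<^sub>3, \<dots>\<close>. A shooting argument on the first chain produces an eigenvalue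
  below \<open>\<alpha>/2\<close>, so \<open>E < \<alpha>/2\<close>. For such an \<open>E\<close> the diagonal dominates so strongly that a solution
  along a chain grows geometrically as soon as two consecutive entries do not decrease in modulus.
  On the two odd chains this happens at the start; on the chain of \<open>g\<^sub>0\<close> it happens at the second step,
  because the hypothesis gives \<open>(\<beta>/2 - E)\<inverse> \<le> \<alpha>\<close>. Since the coefficients of an \<open>L\<^sup>2\<close> function are
  bounded, an eigenfunction for \<open>E\<close> lives on the first chain alone, and there it is determined by \<open>f\<^sub>0\<close>.
\<close>

section \<open>Hermite functions\<close>

text \<open>No variational principle is invoked. \<open>lowest_eigenvalue\<close> only compares
  eigenvalues of a closed graph, so the bound E \<le> \<alpha>/2 requires an actual eigenvector. The
  shooting solution decays at least like 2^(-k), which beats the linear growth of the off-diagonal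
  entries; truncated sums and their images therefore both converge, and the closed graph contains
  the limit.

  In the other direction, an eigenvector is only known as a limit point of the graph over Schwartz
  functions. Each row of the recurrence involves three coefficients, which are continuous
  functionals, so it survives the closure and no regularity theory is required. Completeness of the
  Hermite functions then turns statements about coefficients into statements about vectors.

  All growth estimates compare (n + 1/2)\<alpha> - E \<ge> 2n, which comes from \<alpha> > 2 and E
  \<le> \<alpha>/2, with off-diagonal entries of at most (n + 3/2)/2. The exceptional row is that of
  g_0: its diagonal entry \<beta>/2 - E may be small, so growth is not forced there, and the last
  hypothesis controls exactly this entry.\<close>

definition gauss_poly :: "real poly \<Rightarrow> real \<Rightarrow> real" where
  "gauss_poly p x = poly p x * exp (- x\<^sup>2 / 2)"

lemma gauss_poly_add: "gauss_poly (p + q) x = gauss_poly p x + gauss_poly q x"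
  by (simp add: gauss_poly_def algebra_simps)

lemma gauss_poly_diff: "gauss_poly (p - q) x = gauss_poly p x - gauss_poly q x"
  by (simp add: gauss_poly_def algebra_simps)

lemma gauss_poly_smult: "gauss_poly (smult c p) x = c * gauss_poly p x"
  by (simp add: gauss_poly_def)

lemma gauss_poly_pCons_0: "gauss_poly (pCons 0 p) x = x * gauss_poly p x"
  by (simp add: gauss_poly_def)

text \<open>Differentiation of p exp(-x^2/2), read off on the polynomial factor. In this encoding
  the identities for Hermite functions become polynomial identities.\<close>

definition gauss_deriv :: "real poly \<Rightarrow> real poly" where
  "gauss_deriv p = pderiv p - pCons 0 p"

lemma gauss_poly_has_real_derivative:
  "(gauss_poly p has_real_derivative gauss_poly (gauss_deriv p) x) (at x)"
  unfolding gauss_poly_def gauss_deriv_def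
  by (auto intro!: derivative_eq_intros simp: algebra_simps)

lemma continuous_on_gauss_poly: "continuous_on A (gauss_poly p)"
  by (meson DERIV_isCont continuous_at_imp_continuous_on gauss_poly_has_real_derivative)

lemma borel_measurable_gauss_poly [measurable]: "gauss_poly p \<in> borel_measurable borel"
  by (rule borel_measurable_continuous_onI[OF continuous_on_gauss_poly])

text \<open>A single term of the exponential series bounds (x^2/2)^m / m! by exp(x^2/2), and |x|^m
  \<le> 1 + x^(2m) reduces every power to an even one.\<close>

lemma bounded_power_gauss: "bounded (range (\<lambda>x::real. x ^ m * exp (- x\<^sup>2 / 2)))"
proof -
  have "\<bar>x ^ m * exp (- x\<^sup>2 / 2)\<bar> \<le> 1 + 2 ^ m * fact m" for x :: real
  proof -
    have "inverse (fact m) *\<^sub>R (x\<^sup>2 / 2) ^ m = (\<Sum>k\<in>{m}. inverse (fact k) *\<^sub>R (x\<^sup>2 / 2) ^ k)"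
      by simp
    also have "\<dots> \<le> exp (x\<^sup>2 / 2)"
      unfolding exp_def by (intro sum_le_suminf summable_exp_generic) auto
    finally have "(x\<^sup>2) ^ m \<le> 2 ^ m * fact m * exp (x\<^sup>2 / 2)"
      by (simp add: power_divide field_simps)
    moreover have "\<bar>x\<bar> ^ m \<le> 1 + (x\<^sup>2) ^ m"
    proof -
      have "(x\<^sup>2) ^ m = (\<bar>x\<bar> ^ m)\<^sup>2"
        by (metis power2_abs power_mult mult.commute)
      then show ?thesis
        using sum_squares_bound[of "\<bar>x\<bar> ^ m" 1] zero_le_power[OF abs_ge_zero, of x m]
        unfolding mult_1_right power_one by linarith
    qed
    moreover have "1 \<le> exp (x\<^sup>2 / 2)" by simp
    ultimately have "\<bar>x\<bar> ^ m \<le> exp (x\<^sup>2 / 2) + 2 ^ m * fact m * exp (x\<^sup>2 / 2)"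
      by linarith
    then have "\<bar>x\<bar> ^ m \<le> (1 + 2 ^ m * fact m) * exp (x\<^sup>2 / 2)"
      by (simp add: algebra_simps)
    then have "\<bar>x\<bar> ^ m * exp (- x\<^sup>2 / 2) \<le> (1 + 2 ^ m * fact m) * exp (x\<^sup>2 / 2) * exp (- x\<^sup>2 / 2)"
      by (intro mult_right_mono) auto
    also have "\<dots> = 1 + 2 ^ m * fact m"
      by (simp add: mult.assoc flip: exp_add)
    finally show ?thesis by (simp add: abs_mult power_abs)
  qed
  then show ?thesis by (auto simp: bounded_iff)
qed

lemma bounded_gauss_poly: "bounded (range (gauss_poly p))"
proof -
  \<comment> \<open>The extra power of x is carried along because peeling off \<open>pCons\<close>
    trades one degree of p for one more factor x.\<close>
  have "bounded (range (\<lambda>x. x ^ m * gauss_poly p x))" for m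
  proof (induction p arbitrary: m)
    case 0
    show ?case by (simp add: gauss_poly_def)
  next
    case (pCons a p)
    have "(\<lambda>x. x ^ m * gauss_poly (pCons a p) x)
        = (\<lambda>x. a *\<^sub>R (x ^ m * exp (- x\<^sup>2 / 2)) + x ^ Suc m * gauss_poly p x)"
      by (auto simp: gauss_poly_def algebra_simps)
    then show ?case
      using bounded_plus_comp[OF bounded_scaleR_comp[OF bounded_power_gauss[of m], of a] pCons.IH[of "Suc m"]]
      by (simp only:)
  qed
  from this[of 0] show ?thesis by simp
qed

text \<open>Boundedness applied to (1 + x^2) p. The majorant 1/(1 + x^2) is integrable and vanishes
  at both ends of the line.\<close>

lemma gauss_poly_decay: "\<exists>C. \<forall>x. \<bar>gauss_poly p x\<bar> \<le> C * inverse (1 + x\<^sup>2)"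
proof -
  obtain C where C: "\<And>x. \<bar>gauss_poly ([:1, 0, 1:] * p) x\<bar> \<le> C"
    using bounded_gauss_poly[of "[:1, 0, 1:] * p"] by (auto simp: bounded_iff)
  have "\<bar>gauss_poly p x\<bar> \<le> C * inverse (1 + x\<^sup>2)" for x
  proof -
    have "gauss_poly ([:1, 0, 1:] * p) x = (1 + x\<^sup>2) * gauss_poly p x"
      by (simp add: gauss_poly_def power2_eq_square algebra_simps)
    moreover have pos: "1 + x\<^sup>2 > 0" by (simp add: add_pos_nonneg)
    ultimately have "(1 + x\<^sup>2) * \<bar>gauss_poly p x\<bar> \<le> C"
      using C[of x] by (simp add: abs_mult)
    then show ?thesis using pos by (simp add: field_simps)
  qed
  then show ?thesis by blast
qed

lemma integrable_inverse_1_plus_square_lborel: "integrable lborel (\<lambda>x::real. inverse (1 + x\<^sup>2))"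
  using integrable_I0i_1_div_plus_square LBINT_I0i_1_div_plus_square integrable_inverse_1_plus_square
  by (simp add: set_integrable_def)

lemma integrable_gauss_poly_scaleR:
  fixes g :: "real \<Rightarrow> 'a::euclidean_space"
  assumes [measurable]: "g \<in> borel_measurable borel" and "bounded (range g)"
  shows "integrable lborel (\<lambda>x. gauss_poly p x *\<^sub>R g x)"
proof -
  obtain C where C: "\<And>x. \<bar>gauss_poly p x\<bar> \<le> C * inverse (1 + x\<^sup>2)"
    using gauss_poly_decay by blast
  obtain B where B: "\<And>x. norm (g x) \<le> B" using assms(2) by (auto simp: bounded_iff)
  have "integrable lborel (\<lambda>x. C * inverse (1 + x\<^sup>2) * B)"
    using integrable_inverse_1_plus_square_lborel by simp
  then show ?thesis
  proof (rule Bochner_Integration.integrable_bound)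
    show "AE x in lborel. norm (gauss_poly p x *\<^sub>R g x) \<le> norm (C * inverse (1 + x\<^sup>2) * B)"
    proof (rule AE_I2)
      fix x
      have "norm (gauss_poly p x *\<^sub>R g x) \<le> (C * inverse (1 + x\<^sup>2)) * B"
        unfolding norm_scaleR by (intro mult_mono' C B) auto
      then show "norm (gauss_poly p x *\<^sub>R g x) \<le> norm (C * inverse (1 + x\<^sup>2) * B)" by simp
    qed
  qed simp
qed

lemma integrable_gauss_poly: "integrable lborel (gauss_poly p)"
  using integrable_gauss_poly_scaleR[of "\<lambda>_. 1 :: real" p] by simp

text \<open>The product of the Gaussian factor with g is an antiderivative that vanishes at both
  infinities. Boundedness of g and its derivative suffices, so this serves Schwartz functions and
  Hermite functions alike.\<close>

lemma gauss_poly_by_parts: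
  fixes g g' :: "real \<Rightarrow> 'a::euclidean_space"
  assumes g: "\<And>x. (g has_vector_derivative g' x) (at x)"
    and g': "continuous_on UNIV g'" and bdd: "bounded (range g)" "bounded (range g')"
  shows "(\<integral>x. gauss_poly p x *\<^sub>R g' x \<partial>lborel) = - (\<integral>x. gauss_poly (gauss_deriv p) x *\<^sub>R g x \<partial>lborel)"
proof -
  have gc: "continuous_on UNIV g"
    by (meson g continuous_at_imp_continuous_on has_vector_derivative_continuous)
  have [measurable]: "g \<in> borel_measurable borel" "g' \<in> borel_measurable borel"
    using gc g' by (auto intro: borel_measurable_continuous_onI)
  define F where "F x = gauss_poly p x *\<^sub>R g x" for x
  define f where "f x = gauss_poly p x *\<^sub>R g' x + gauss_poly (gauss_deriv p) x *\<^sub>R g x" for x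
  have i1: "integrable lborel (\<lambda>x. gauss_poly p x *\<^sub>R g' x)"
    and i2: "integrable lborel (\<lambda>x. gauss_poly (gauss_deriv p) x *\<^sub>R g x)"
    using bdd by (auto intro: integrable_gauss_poly_scaleR)
  have int: "integrable lborel f" unfolding f_def using i1 i2 by simp
  have F: "(F has_vector_derivative f x) (at x)" for x
    unfolding F_def f_def
    by (rule has_vector_derivative_scaleR[OF _ g]) (rule gauss_poly_has_real_derivative)
  have fc: "continuous_on UNIV f"
    unfolding f_def by (intro continuous_intros continuous_on_gauss_poly gc g')
  obtain C where C: "\<And>x. \<bar>gauss_poly p x\<bar> \<le> C * inverse (1 + x\<^sup>2)"
    using gauss_poly_decay by blast
  obtain B where B: "\<And>x. norm (g x) \<le> B" using bdd(1) by (auto simp: bounded_iff)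
  have bound: "norm (F x) \<le> C * inverse (1 + x\<^sup>2) * B" for x
    unfolding F_def norm_scaleR by (intro mult_mono' C B) auto
  have lim: "((\<lambda>x. C * inverse (1 + x\<^sup>2) * B) \<longlongrightarrow> 0) at_top" "((\<lambda>x. C * inverse (1 + x\<^sup>2) * B) \<longlongrightarrow> 0) at_bot"
    for C B :: real
    by real_asymp+
  have T: "(F \<longlongrightarrow> 0) at_top"
    by (rule Lim_null_comparison[OF _ lim(1)]) (use bound in \<open>intro always_eventually allI\<close>)
  have Bt: "(F \<longlongrightarrow> 0) at_bot"
    by (rule Lim_null_comparison[OF _ lim(2)]) (use bound in \<open>intro always_eventually allI\<close>)
  have "interval_lebesgue_integral lborel (-\<infinity>) \<infinity> f = 0 - 0"
  proof (rule interval_integral_FTC_integrable)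
    show "isCont f x" for x using fc by (simp add: continuous_on_eq_continuous_at)
    show "set_integrable lborel (einterval (-\<infinity>) \<infinity>) f"
      using int by (simp add: set_integrable_def)
    show "((F \<circ> real_of_ereal) \<longlongrightarrow> 0) (at_right (-\<infinity>))"
      using Bt by (simp add: ereal_tendsto_simps)
    show "((F \<circ> real_of_ereal) \<longlongrightarrow> 0) (at_left \<infinity>)"
      using T by (simp add: ereal_tendsto_simps)
  qed (use F in auto)
  then have "(\<integral>x. f x \<partial>lborel) = 0"
    by (simp add: interval_lebesgue_integral_def set_lebesgue_integral_def)
  then show ?thesis
    unfolding f_def using i1 i2 by (simp add: add_eq_0_iff)
qed

lemma schwartz_gauss_poly: "schwartz (\<lambda>x. gauss_poly p x *\<^sub>R v)"
  unfolding schwartz_def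
proof (intro exI[of _ "\<lambda>n x. gauss_poly ((gauss_deriv ^^ n) p) x *\<^sub>R v"] conjI allI)
  fix m n :: nat and x :: real
  show "((\<lambda>x. gauss_poly ((gauss_deriv ^^ n) p) x *\<^sub>R v) has_vector_derivative
      gauss_poly ((gauss_deriv ^^ Suc n) p) x *\<^sub>R v) (at x)"
    using has_vector_derivative_scaleR[OF gauss_poly_has_real_derivative[of "(gauss_deriv ^^ n) p" x]
        has_vector_derivative_const[of v]]
    by simp
  have "(x ^ m) *\<^sub>R (gauss_poly ((gauss_deriv ^^ n) p) x *\<^sub>R v) =
     gauss_poly (monom 1 m * (gauss_deriv ^^ n) p) x *\<^sub>R v" for x
    by (simp add: gauss_poly_def poly_monom)
  moreover have "bounded (range (\<lambda>x. gauss_poly q x *\<^sub>R v))" for q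
    using bounded_linear_image[OF bounded_gauss_poly[of q] bounded_linear_scaleR_left[of v]]
    by (simp add: image_image)
  ultimately show "bounded (range (\<lambda>x. (x ^ m) *\<^sub>R (gauss_poly ((gauss_deriv ^^ n) p) x *\<^sub>R v)))"
    by presburger
qed simp

text \<open>These are H_n / sqrt(2^n n!) with H_n the physicists' Hermite polynomials. This scaling
  makes multiplication by x a symmetric matrix and differentiation an antisymmetric one.\<close>

fun hermite_poly :: "nat \<Rightarrow> real poly" where
  "hermite_poly 0 = 1"
| "hermite_poly (Suc 0) = smult (sqrt 2) [:0, 1:]"
| "hermite_poly (Suc (Suc n)) = smult (1 / sqrt (n + 2))
     (smult (sqrt 2) (pCons 0 (hermite_poly (Suc n))) - smult (sqrt (n + 1)) (hermite_poly n))"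

definition hermite_fun :: "nat \<Rightarrow> real \<Rightarrow> real" where
  "hermite_fun n = gauss_poly (hermite_poly n)"

section \<open>Ladder relations. At n = 0 the index n - 1 truncates to 0, but its factor
  vanishes\<close>

lemma pCons_hermite_poly:
  "smult (sqrt 2) (pCons 0 (hermite_poly n)) =
     smult (sqrt (n + 1)) (hermite_poly (n + 1)) + smult (sqrt n) (hermite_poly (n - 1))"
proof (cases n)
  case 0
  then show ?thesis by simp
next
  case (Suc k)
  have "sqrt (real k + 2) \<noteq> 0" by simp
  then show ?thesis using Suc by (simp add: algebra_simps)
qed

text \<open>Differentiate the recursion. The two induction hypotheses combine, again by the
  recursion, into sqrt(n + 1) times the polynomial of index n + 1, and 1 + (n + 1) = n + 2 gives the
  constant.\<close>

lemma pderiv_hermite_poly: "pderiv (hermite_poly n) = smult (sqrt (2 * n)) (hermite_poly (n - 1))"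
proof (induction n rule: hermite_poly.induct)
  case (3 n)
  have *: "sqrt (real n + 2) * sqrt (real n + 2) = real n + 2"
    "sqrt (real n + 1) * sqrt (real n + 1) = real n + 1" by simp_all
  have IH1: "pderiv (hermite_poly (Suc n)) = smult (sqrt 2 * sqrt (n + 1)) (hermite_poly n)"
    using 3(1) unfolding real_sqrt_mult[symmetric] by (simp add: algebra_simps)
  have IH2: "pderiv (hermite_poly n) = smult (sqrt 2 * sqrt n) (hermite_poly (n - 1))"
    using 3(2) unfolding real_sqrt_mult[symmetric] by simp
  have "smult (sqrt (real n + 2)) (pderiv (hermite_poly (Suc (Suc n)))) =
     smult (sqrt 2) (hermite_poly (Suc n))
     + smult (sqrt 2 * sqrt (n + 1)) (smult (sqrt 2) (pCons 0 (hermite_poly n)) - smult (sqrt n) (hermite_poly (n - 1)))"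
    by (simp add: pderiv_smult pderiv_diff pderiv_pCons IH1 IH2 algebra_simps smult_diff_right smult_add_right)
  also have "smult (sqrt 2) (pCons 0 (hermite_poly n)) - smult (sqrt n) (hermite_poly (n - 1))
     = smult (sqrt (n + 1)) (hermite_poly (Suc n))"
    using pCons_hermite_poly[of n] by (simp add: algebra_simps)
  also have "smult (sqrt 2) (hermite_poly (Suc n)) + smult (sqrt 2 * sqrt (n + 1)) \<dots>
     = smult (sqrt (real n + 2)) (smult (sqrt 2 * sqrt (real n + 2)) (hermite_poly (Suc n)))"
    by (simp add: * smult_add_left[symmetric] algebra_simps)
  finally have "pderiv (hermite_poly (Suc (Suc n))) = smult (sqrt 2 * sqrt (real n + 2)) (hermite_poly (Suc n))"
    by (metis (no_types, lifting) add_nonneg_eq_0_iff of_nat_0_le_iff real_sqrt_eq_0_iff smult_cancel zero_le_numeral zero_neq_numeral)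
  then show ?case by (simp add: real_sqrt_mult[symmetric] algebra_simps)
qed (simp_all add: pderiv_pCons)

lemma gauss_deriv_hermite_lower:
  "gauss_deriv (hermite_poly n) = smult (sqrt (2 * n)) (hermite_poly (n - 1)) - pCons 0 (hermite_poly n)"
  by (simp add: gauss_deriv_def pderiv_hermite_poly)

lemma pCons_hermite_poly_normalized:
  "pCons 0 (hermite_poly n) =
     smult (sqrt ((n + 1) / 2)) (hermite_poly (n + 1)) + smult (sqrt (n / 2)) (hermite_poly (n - 1))"
proof -
  have "2 * ((real n + 1) / 2) = real n + 1" "2 * (real n / 2) = real n"
    by simp_all
  then have "smult (sqrt 2) (pCons 0 (hermite_poly n)) = smult (sqrt 2)
     (smult (sqrt ((n + 1) / 2)) (hermite_poly (n + 1)) + smult (sqrt (n / 2)) (hermite_poly (n - 1)))"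
    unfolding pCons_hermite_poly smult_add_right smult_smult real_sqrt_mult[symmetric] by (simp only: of_nat_add of_nat_1)
  then show ?thesis unfolding of_nat_add of_nat_1 by (rule smult_cancel[rotated]) simp
qed

lemma hermite_fun_mult_x:
  "x * hermite_fun n x = sqrt ((n + 1) / 2) * hermite_fun (n + 1) x + sqrt (n / 2) * hermite_fun (n - 1) x"
  unfolding hermite_fun_def gauss_poly_pCons_0[symmetric] pCons_hermite_poly_normalized
  by (simp add: gauss_poly_add gauss_poly_smult)

lemma gauss_deriv_hermite_raise:
  "gauss_deriv (hermite_poly n) = pCons 0 (hermite_poly n) - smult (sqrt (2 * (n + 1))) (hermite_poly (n + 1))"
proof -
  have "sqrt (2 * real n) = 2 * sqrt (n / 2)" "sqrt (2 * (real n + 1)) = 2 * sqrt ((n + 1) / 2)"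
    by (rule real_sqrt_unique; simp add: power_mult_distrib)+
  then show ?thesis
    unfolding gauss_deriv_hermite_lower pCons_hermite_poly_normalized
    by (intro poly_eqI) (simp add: algebra_simps)
qed

lemma gauss_deriv_hermite_ladder:
  "gauss_deriv (hermite_poly n) =
     smult (sqrt (n / 2)) (hermite_poly (n - 1)) - smult (sqrt ((n + 1) / 2)) (hermite_poly (n + 1))"
proof -
  have "sqrt (2 * real n) = 2 * sqrt (n / 2)"
    by (simp add: real_sqrt_mult real_sqrt_divide field_simps)
  then show ?thesis
    unfolding gauss_deriv_hermite_lower pCons_hermite_poly_normalized
    by (intro poly_eqI) (simp add: algebra_simps)
qed

lemma gauss_deriv_diff: "gauss_deriv (p - q) = gauss_deriv p - gauss_deriv q"
  by (simp add: gauss_deriv_def pderiv_diff)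

lemma gauss_deriv_smult: "gauss_deriv (smult c p) = smult c (gauss_deriv p)"
  by (simp add: gauss_deriv_def pderiv_smult smult_diff_right)

lemma gauss_deriv_pCons_0: "gauss_deriv (pCons 0 p) = p + pCons 0 (gauss_deriv p)"
  by (simp add: gauss_deriv_def pderiv_pCons)

text \<open>The oscillator equation. The first derivative is written with the lowering form and the
  term of index n - 1 is then differentiated with the raising form, so that all terms of index n - 1
  cancel.\<close>

lemma gauss_deriv2_hermite:
  "gauss_deriv (gauss_deriv (hermite_poly n)) =
     pCons 0 (pCons 0 (hermite_poly n)) - smult (2 * n + 1) (hermite_poly n)"
proof (cases n)
  case 0
  then show ?thesis by (simp add: gauss_deriv_def pderiv_diff pderiv_pCons one_pCons)
next
  case (Suc k)
  have "sqrt (2 * real n) * sqrt (2 * real n) = 2 * real n" by simp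
  have pC: "pCons 0 (p - q) = pCons 0 p - pCons 0 q" "pCons 0 (smult a p) = smult a (pCons 0 p)"
    for p q :: "real poly" and a
    by simp_all
  have "n - 1 + 1 = n" "2 * (real (n - 1) + 1) = 2 * real n" using Suc by simp_all
  note * = this \<open>sqrt (2 * real n) * sqrt (2 * real n) = 2 * real n\<close>
  show ?thesis
    unfolding gauss_deriv_hermite_lower[of n] gauss_deriv_diff gauss_deriv_smult gauss_deriv_pCons_0
      gauss_deriv_hermite_raise[of "n - 1"]
      smult_diff_right smult_smult pC *
    by (intro poly_eqI) (simp add: algebra_simps coeff_pCons split: nat.split)
qed

text \<open>The modulus of the matrix entry of x d/dx + 1/2 between levels n and n + 2.\<close>

definition offdiag :: "nat \<Rightarrow> real" where
  "offdiag n = sqrt ((real n + 1) * (real n + 2)) / 2"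

text \<open>Multiplying the ladder form of the derivative by x produces diagonal terms n/2 and -(n +
  1)/2, which cancel against the added 1/2. Only the levels n - 2 and n + 2 remain, so the parity of
  n is preserved.\<close>

lemma dilation_hermite:
  "pCons 0 (gauss_deriv (hermite_poly n)) + smult (1/2) (hermite_poly n) =
     (if n < 2 then 0 else smult (offdiag (n - 2)) (hermite_poly (n - 2)))
       - smult (offdiag n) (hermite_poly (n + 2))"
proof -
  have pC: "pCons 0 (smult a p - smult b q) = smult a (pCons 0 p) - smult b (pCons 0 q)" for a b :: real and p q
    by simp
  have b: "sqrt ((real n + 1) / 2) * sqrt ((real n + 2) / 2) = offdiag n"
    by (simp add: offdiag_def real_sqrt_mult real_sqrt_divide)
  have s: "sqrt ((real n + 1) / 2) * sqrt ((real n + 1) / 2) = (real n + 1) / 2"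
    "sqrt (real n / 2) * sqrt (real n / 2) = real n / 2" by simp_all
  show ?thesis
  proof (cases n)
    case 0
    then show ?thesis
      by (simp add: gauss_deriv_def offdiag_def real_sqrt_divide field_simps one_pCons)
  next
    case (Suc k)
    have m: "smult (sqrt (real n / 2)) (pCons 0 (hermite_poly (n - 1))) = 
      smult (real n / 2) (hermite_poly n) + (if n < 2 then 0 else smult (offdiag (n - 2)) (hermite_poly (n - 2)))"
    proof (cases k)
      case 0
      have "sqrt (1 / 2) * sqrt (1 / 2) = (1 / 2 :: real)" by simp
      moreover have "sqrt 2 = 2 * sqrt (1 / 2 :: real)" by (rule real_sqrt_unique) (simp_all add: power_mult_distrib)
      ultimately show ?thesis using Suc 0 by (simp add: algebra_simps)
    next
      case (Suc l)
      have "sqrt (real n / 2) * sqrt ((real n - 1) / 2) = offdiag (n - 2)"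
        using Suc \<open>n = Suc k\<close>
        by (simp add: offdiag_def real_sqrt_divide add.commute flip: real_sqrt_mult)
      moreover have "n - 1 - 1 = n - 2" "n - 1 + 1 = n" "real (n - 1) + 1 = real n" "real (n - 1) = real n - 1"
         using Suc \<open>n = Suc k\<close> by auto
      ultimately show ?thesis 
        unfolding pCons_hermite_poly_normalized using Suc \<open>n = Suc k\<close> s by (simp only: smult_add_right smult_smult) simp
    qed
    have p: "smult (sqrt ((real n + 1) / 2)) (pCons 0 (hermite_poly (n + 1))) = 
      smult (offdiag n) (hermite_poly (n + 2)) + smult ((real n + 1) / 2) (hermite_poly n)"
      using b s unfolding pCons_hermite_poly_normalized by (simp add: smult_add_right algebra_simps)
    have "smult (real n / 2) (hermite_poly n) - smult ((real n + 1) / 2) (hermite_poly n) + smult (1/2) (hermite_poly n) = 0"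
      by (simp add: smult_diff_left[symmetric] smult_add_left[symmetric] add_divide_distrib)
    then show ?thesis
      unfolding gauss_deriv_hermite_ladder pC m p by (simp add: algebra_simps)
  qed
qed

section \<open>Hermite coefficients\<close>

lemma borel_measurable_hermite_fun [measurable]: "hermite_fun n \<in> borel_measurable borel"
  by (simp add: hermite_fun_def)

lemma integrable_hermite_fun_mult: "integrable lborel (\<lambda>x. hermite_fun m x * hermite_fun n x)"
proof -
  have "integrable lborel (\<lambda>x. gauss_poly (hermite_poly m) x *\<^sub>R gauss_poly (hermite_poly n) x)"
    by (intro integrable_gauss_poly_scaleR bounded_gauss_poly) simp
  then show ?thesis by (simp add: hermite_fun_def)
qed

text \<open>The functions \<open>hermite_fun n\<close> are not normalised to 1, but they all have the same norm.\<close>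

definition hermite_inner :: "nat \<Rightarrow> nat \<Rightarrow> real" where
  "hermite_inner m n = (\<integral>x. hermite_fun m x * hermite_fun n x \<partial>lborel)"

text \<open>Raising and lowering are adjoint: in the integration by parts one factor is
  differentiated in raising form and the other in lowering form, and the terms with x cancel.
  Orthogonality to level 0 and the equality of all norms follow.\<close>

lemma hermite_inner_raise_lower:
  "sqrt (n + 1) * hermite_inner (n + 1) m = sqrt m * hermite_inner n (m - 1)"
proof -
  have by_parts: "(\<integral>x. gauss_poly (hermite_poly n) x * gauss_poly (gauss_deriv (hermite_poly m)) x \<partial>lborel)
    = - (\<integral>x. gauss_poly (gauss_deriv (hermite_poly n)) x * gauss_poly (hermite_poly m) x \<partial>lborel)"
    using gauss_poly_by_parts[of "gauss_poly (hermite_poly m)" "gauss_poly (gauss_deriv (hermite_poly m))" "hermite_poly n"]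
      bounded_gauss_poly continuous_on_gauss_poly gauss_poly_has_real_derivative
    by (simp add: has_real_derivative_iff_has_vector_derivative)
  have i: "integrable lborel (\<lambda>x. gauss_poly p x * gauss_poly q x)" for p q
    using integrable_gauss_poly_scaleR[of "gauss_poly q" p] bounded_gauss_poly by simp
  have l: "gauss_poly (hermite_poly n) x * gauss_poly (gauss_deriv (hermite_poly m)) x =
      sqrt (2 * m) * (hermite_fun n x * hermite_fun (m - 1) x) - gauss_poly (pCons 0 (hermite_poly n)) x * hermite_fun m x" for x
    by (simp add: gauss_deriv_hermite_lower gauss_poly_diff gauss_poly_smult gauss_poly_pCons_0
        hermite_fun_def algebra_simps)
  have r: "gauss_poly (gauss_deriv (hermite_poly n)) x * gauss_poly (hermite_poly m) x =
     gauss_poly (pCons 0 (hermite_poly n)) x * hermite_fun m x - sqrt (2 * (n + 1)) * (hermite_fun (n + 1) x * hermite_fun m x)" for x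
    by (simp add: gauss_deriv_hermite_raise gauss_poly_diff gauss_poly_smult gauss_poly_pCons_0
        hermite_fun_def algebra_simps)
  have "sqrt (2 * m) * hermite_inner n (m - 1) = sqrt (2 * (n + 1)) * hermite_inner (n + 1) m"
    using by_parts unfolding l r
    by (simp add: i hermite_fun_def hermite_inner_def)
  moreover have "sqrt (2 * (real n + 1)) = sqrt 2 * sqrt (real n + 1)" "sqrt (2 * real m) = sqrt 2 * sqrt m"
    by (rule real_sqrt_mult)+
  ultimately show ?thesis by (simp add: add.commute)
qed

lemma hermite_inner_0: "n > 0 \<Longrightarrow> hermite_inner n 0 = 0"
  using hermite_inner_raise_lower[of "n - 1" 0] by (cases n) auto

lemma hermite_inner_self: "hermite_inner n n = hermite_inner 0 0"
proof (induction n)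
  case (Suc n)
  have "sqrt (real n + 1) \<noteq> 0" by simp
  then show ?case using hermite_inner_raise_lower[of n "Suc n"] Suc by (simp add: add.commute)
qed simp

lemma hermite_inner_0_0_pos: "hermite_inner 0 0 > 0"
proof -
  have "hermite_inner 0 0 \<ge> 0" unfolding hermite_inner_def by simp
  moreover have "hermite_inner 0 0 \<noteq> 0"
  proof
    assume "hermite_inner 0 0 = 0"
    then have "AE x in lborel. hermite_fun 0 x * hermite_fun 0 x = 0"
      unfolding hermite_inner_def
      by (subst (asm) integral_nonneg_eq_0_iff_AE) (auto intro: integrable_hermite_fun_mult)
    then have "AE x::real in lborel. False"
      by (rule AE_mp) (simp add: hermite_fun_def gauss_poly_def)
    then show False
      by (simp add: AE_iff_null null_sets_def)
  qed
  ultimately show ?thesis by simp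
qed

lemma square_integrable_gauss_poly: "square_integrable (\<lambda>x. gauss_poly p x *\<^sub>R v)"
  by (rule square_integrable_schwartz(1)[OF schwartz_gauss_poly])

lift_definition coef :: "nat \<Rightarrow> l2 \<Rightarrow> complex^2" is "\<lambda>n f. \<integral>x. hermite_fun n x *\<^sub>R f x \<partial>lborel"
proof -
  fix n and f g :: "real \<Rightarrow> complex^2"
  assume "l2_eq f g"
  then show "(\<integral>x. hermite_fun n x *\<^sub>R f x \<partial>lborel) = (\<integral>x. hermite_fun n x *\<^sub>R g x \<partial>lborel)"
    by (intro integral_cong_AE) (auto simp: l2_eq_def square_integrable_def)
qed

definition basis :: "nat \<Rightarrow> complex^2 \<Rightarrow> l2" where
  "basis n v = abs_l2 (\<lambda>x. hermite_fun n x *\<^sub>R v)"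

lemma integrable_hermite_fun_scaleR:
  assumes "square_integrable f"
  shows "integrable lborel (\<lambda>x. hermite_fun n x *\<^sub>R f x)"
proof (rule Bochner_Integration.integrable_bound)
  show "integrable lborel (\<lambda>x. hermite_fun n x * hermite_fun n x + (norm (f x))\<^sup>2)"
    using assms by (auto simp: square_integrable_def intro: integrable_hermite_fun_mult)
  show "(\<lambda>x. hermite_fun n x *\<^sub>R f x) \<in> borel_measurable lborel"
    using assms by (auto simp: square_integrable_def)
  have "\<bar>h\<bar> * y \<le> h * h + y\<^sup>2" if "y \<ge> 0" for h y :: real
    using sum_squares_bound[of "\<bar>h\<bar>" y] mult_nonneg_nonneg[OF abs_ge_zero[of h] that]
    unfolding power2_abs power2_eq_square by linarith
  then show "AE x in lborel. norm (hermite_fun n x *\<^sub>R f x) \<le> norm (hermite_fun n x * hermite_fun n x + (norm (f x))\<^sup>2)"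
    by auto
qed

lemma l2_eq_refl: "square_integrable f \<Longrightarrow> l2_eq f f"
  by (simp add: l2_eq_def)

lemma coef_abs: "square_integrable f \<Longrightarrow> coef n (abs_l2 f) = (\<integral>x. hermite_fun n x *\<^sub>R f x \<partial>lborel)"
  by (simp add: coef.abs_eq l2_eq_refl)

lemma square_integrable_hermite: "square_integrable (\<lambda>x. hermite_fun n x *\<^sub>R v)"
  unfolding hermite_fun_def by (rule square_integrable_gauss_poly)

lemma coef_add: "coef n (u + v) = coef n u + coef n v"
  by transfer (simp add: l2_eq_def scaleR_add_right integrable_hermite_fun_scaleR)

lemma coef_scaleR: "coef n (r *\<^sub>R u) = r *\<^sub>R coef n u"
proof (transfer)
  fix n r and f :: "real \<Rightarrow> complex^2"
  show "(\<integral>x. hermite_fun n x *\<^sub>R r *\<^sub>R f x \<partial>lborel) = r *\<^sub>R (\<integral>x. hermite_fun n x *\<^sub>R f x \<partial>lborel)"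
    by (simp add: scaleR_left_commute[of _ r] del: scaleR_scaleR)
qed

lemma bounded_linear_smult: "bounded_linear (\<lambda>v::complex^2. c *s v)"
  using linear_vector_smult linear_conv_bounded_linear by blast

lemma coef_scaleC: "coef n (scaleC c u) = c *s coef n u"
proof (transfer)
  fix n c and f :: "real \<Rightarrow> complex^2"
  assume "l2_eq f f"
  then have "integrable lborel (\<lambda>x. hermite_fun n x *\<^sub>R f x)"
    by (simp add: l2_eq_def integrable_hermite_fun_scaleR)
  from integral_bounded_linear[OF bounded_linear_smult this, of c]
  have "(\<integral>x. c *s (hermite_fun n x *\<^sub>R f x) \<partial>lborel) = c *s (\<integral>x. hermite_fun n x *\<^sub>R f x \<partial>lborel)" .
  moreover have "c *s (hermite_fun n x *\<^sub>R f x) = hermite_fun n x *\<^sub>R (c *s f x)" for x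
    by (simp add: vec_eq_iff)
  ultimately show "(\<integral>x. hermite_fun n x *\<^sub>R (c *s f x) \<partial>lborel) = c *s (\<integral>x. hermite_fun n x *\<^sub>R f x \<partial>lborel)"
    by simp
qed

lemma coef_diff: "coef n (u - v) = coef n u - coef n v"
  using coef_add[of n "u - v" v] by simp

lemma l2_cases:
  obtains f where "square_integrable f" "u = abs_l2 f"
proof -
  have "\<exists>f. square_integrable f \<and> u = abs_l2 f"
    by (rule l2.abs_induct[of _ u]) (auto simp: l2_eq_def)
  then show ?thesis using that by blast
qed

lemma inner_basis: "u \<bullet> basis n v = coef n u \<bullet> v"
proof -
  obtain f where f: "square_integrable f" "u = abs_l2 f" by (rule l2_cases)
  have "u \<bullet> basis n v = (\<integral>x. f x \<bullet> (hermite_fun n x *\<^sub>R v) \<partial>lborel)"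
    unfolding basis_def f(2) by (intro inner_l2.abs_eq l2_eq_refl f square_integrable_hermite)
  also have "\<dots> = (\<integral>x. hermite_fun n x *\<^sub>R f x \<partial>lborel) \<bullet> v"
    using integral_inner_left[OF integrable_hermite_fun_scaleR[OF f(1)], of n v] by simp
  finally show ?thesis by (simp add: coef_abs f)
qed

lemma coef_basis: "coef m (basis n v) = hermite_inner m n *\<^sub>R v"
  unfolding basis_def
  by (simp add: coef_abs square_integrable_hermite hermite_inner_def integrable_hermite_fun_mult)

lemma norm_basis: "norm (basis n v) = sqrt (hermite_inner 0 0) * norm v"
  by (simp add: norm_eq_sqrt_inner[of "basis n v"] inner_basis coef_basis hermite_inner_self[of n] real_sqrt_mult
      norm_eq_sqrt_inner[of v])

text \<open>Cauchy-Schwarz against \<open>basis n (coef n u)\<close>. It makes \<open>coef\<close>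
  continuous, and being uniform in n it supplies the bound that growing solutions violate.\<close>

lemma norm_coef_le: "norm (coef n u) \<le> sqrt (hermite_inner 0 0) * norm u"
proof (cases "coef n u = 0")
  case False
  have "norm (coef n u) * norm (coef n u) = u \<bullet> basis n (coef n u)"
    by (simp add: inner_basis dot_square_norm power2_eq_square)
  also have "\<dots> \<le> norm u * (sqrt (hermite_inner 0 0) * norm (coef n u))"
    using norm_cauchy_schwarz[of u "basis n (coef n u)"] by (simp add: norm_basis)
  finally show ?thesis using False by (simp add: algebra_simps)
qed (use hermite_inner_0_0_pos in simp)

lemma bounded_linear_coef: "bounded_linear (coef n)"
  by (rule bounded_linear_intro[where K = "sqrt (hermite_inner 0 0)"])
    (use norm_coef_le in \<open>auto simp: coef_add coef_scaleR mult.commute\<close>)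

section \<open>Completeness of the Hermite functions\<close>

lemma emeasure_density_ennreal:
  assumes "integrable lborel f" "\<And>x::real. 0 \<le> f x"
  shows "emeasure (density lborel (\<lambda>x. ennreal (f x))) UNIV = ennreal (\<integral>x. f x \<partial>lborel)"
  using assms by (subst emeasure_density) (auto simp: nn_integral_eq_integral)

lemma char_density_pos:
  assumes "integrable lborel (f :: real \<Rightarrow> real)" "\<And>x. 0 \<le> f x"
  shows "char (density lborel f) t = (\<integral>x. f x *\<^sub>R iexp (t * x) \<partial>lborel)"
  unfolding char_def using assms
  by (subst integral_density) auto

text \<open>The positive and negative parts of F have the same Fourier transform. At t = 0 this says
  that their masses agree; if the mass is not zero, both are normalised to probability densities and
  Levy's uniqueness theorem identifies them.\<close>

lemma fourier_zero_imp_zero: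
  fixes F :: "real \<Rightarrow> real"
  assumes int: "integrable lborel F"
    and zero: "\<And>t. (\<integral>x. F x *\<^sub>R iexp (t * x) \<partial>lborel) = 0"
  shows "AE x in lborel. F x = 0"
proof -
  have [measurable]: "F \<in> borel_measurable borel" using int by auto
  define P where "P x = max (F x) 0" for x
  define N where "N x = max (- F x) 0" for x
  have intP: "integrable lborel P" and intN: "integrable lborel N"
    unfolding P_def N_def using int by auto
  have pos: "0 \<le> P x" "0 \<le> N x" for x by (auto simp: P_def N_def)
  have F: "F x = P x - N x" for x by (auto simp: P_def N_def)
  have intE: "integrable lborel (\<lambda>x. f x *\<^sub>R iexp (t * x))" if "integrable lborel f" for f :: "real \<Rightarrow> real" and t
    by (rule Bochner_Integration.integrable_bound[OF that]) (use that in auto)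
  have eq: "(\<integral>x. P x *\<^sub>R iexp (t * x) \<partial>lborel) = (\<integral>x. N x *\<^sub>R iexp (t * x) \<partial>lborel)" for t
    using zero[of t] intE[OF intP, of t] intE[OF intN, of t]
    unfolding F scaleR_diff_left by simp
  define c where "c = (\<integral>x. P x \<partial>lborel)"
  have cN: "c = (\<integral>x. N x \<partial>lborel)"
    using eq[of 0] unfolding c_def by (simp add: scaleR_conv_of_real)
  have c0: "c \<ge> 0" unfolding c_def using pos by simp
  show ?thesis
  proof (cases "c = 0")
    case True
    then have "AE x in lborel. P x = 0" "AE x in lborel. N x = 0"
      using integral_nonneg_eq_0_iff_AE[OF intP] integral_nonneg_eq_0_iff_AE[OF intN] pos cN
      unfolding c_def by auto
    then show ?thesis by eventually_elim (simp add: F)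
  next
    case False
    have rd: "real_distribution (density lborel (\<lambda>x. ennreal (f x / c)))"
      if "integrable lborel f" "\<And>x. 0 \<le> f x" "c = (\<integral>x. f x \<partial>lborel)" for f
    proof (intro real_distribution.intro prob_spaceI real_distribution_axioms.intro)
      show "emeasure (density lborel (\<lambda>x. ennreal (f x / c))) (space (density lborel (\<lambda>x. ennreal (f x / c)))) = 1"
        using emeasure_density_ennreal[of "\<lambda>x. f x / c"] that c0 False by simp
    qed auto
    have ch: "char (density lborel (\<lambda>x. ennreal (f x / c))) t = (\<integral>x. f x *\<^sub>R iexp (t * x) \<partial>lborel) / c"
      if "integrable lborel f" "\<And>x. 0 \<le> f x" for f t
    proof -
      have "char (density lborel (\<lambda>x. ennreal (f x / c))) t = (\<integral>x. (f x / c) *\<^sub>R iexp (t * x) \<partial>lborel)"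
        using that c0 by (intro char_density_pos) auto
      also have "\<dots> = (\<integral>x. (f x *\<^sub>R iexp (t * x)) / c \<partial>lborel)"
        by (intro Bochner_Integration.integral_cong) (auto simp: scaleR_conv_of_real)
      also have "\<dots> = (\<integral>x. f x *\<^sub>R iexp (t * x) \<partial>lborel) / c"
        by (rule integral_divide_zero)
      finally show ?thesis .
    qed
    have "density lborel (\<lambda>x. ennreal (P x / c)) = density lborel (\<lambda>x. ennreal (N x / c))"
    proof (intro Levy_uniqueness rd ext)
      show "char (density lborel (\<lambda>x. ennreal (P x / c))) t = char (density lborel (\<lambda>x. ennreal (N x / c))) t" for t
        unfolding ch[OF intP pos(1)] ch[OF intN pos(2)] eq ..
    qed (use intP intN pos cN c_def in auto)
    then have "AE x in lborel. ennreal (P x / c) = ennreal (N x / c)"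
      using intP intN by (intro sigma_finite_measure.density_unique[OF sigma_finite_lborel]) auto
    then show ?thesis
    proof eventually_elim
      case (elim x)
      then have "P x / c = N x / c" using pos[of x] c0 by (simp add: ennreal_inj)
      then show ?case using False by (simp add: F)
    qed
  qed
qed

text \<open>Exponential integrability lets the power series of exp(itx) be integrated term by term:
  its partial sums against F are dominated by exp(|t||x|) |F|. Every Fourier coefficient is thus a
  limit of combinations of vanishing moments.\<close>

lemma moments_zero_imp_zero:
  fixes F :: "real \<Rightarrow> real"
  assumes meas [measurable]: "F \<in> borel_measurable borel"
    and int: "\<And>t. integrable lborel (\<lambda>x. exp (t * \<bar>x\<bar>) * F x)"
    and zero: "\<And>m. (\<integral>x. x ^ m * F x \<partial>lborel) = 0"
  shows "AE x in lborel. F x = 0"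
proof (rule fourier_zero_imp_zero)
  show "integrable lborel F" using int[of 0] by simp
  fix t :: real
  define s where "s N x = (\<Sum>m<N. (\<i> * (t * x)) ^ m /\<^sub>R fact m * F x)" for N and x :: real
  have intm: "integrable lborel (\<lambda>x. x ^ m * F x)" for m
  proof (rule Bochner_Integration.integrable_bound)
    show "integrable lborel (\<lambda>x. fact m * (exp (1 * \<bar>x\<bar>) * F x))" using int[of 1] by simp
    have "\<bar>x\<bar> ^ m \<le> fact m * exp \<bar>x\<bar>" for x :: real
    proof -
      have "inverse (fact m) *\<^sub>R \<bar>x\<bar> ^ m = (\<Sum>k\<in>{m}. inverse (fact k) *\<^sub>R \<bar>x\<bar> ^ k)"
        by simp
      also have "\<dots> \<le> exp \<bar>x\<bar>"
        unfolding exp_def by (intro sum_le_suminf summable_exp_generic) auto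
      finally show ?thesis by (simp add: field_simps)
    qed
    then show "AE x in lborel. norm (x ^ m * F x) \<le> norm (fact m * (exp (1 * \<bar>x\<bar>) * F x))"
      by (auto intro!: AE_I2 mult_right_mono simp: abs_mult power_abs simp flip: mult.assoc)
  qed simp
  have "(\<integral>x. s N x \<partial>lborel) = 0" for N
  proof -
    have *: "(\<i> * (t * x)) ^ m /\<^sub>R fact m * F x = ((\<i> * t) ^ m / fact m) * complex_of_real (x ^ m * F x)" for m x
      by (simp add: scaleR_conv_of_real power_mult_distrib field_simps)
    have "(\<integral>x. s N x \<partial>lborel) = (\<Sum>m<N. (\<integral>x. ((\<i> * t) ^ m / fact m) * complex_of_real (x ^ m * F x) \<partial>lborel))"
      unfolding s_def *
      by (intro Bochner_Integration.integral_sum integrable_mult_right integrable_of_real intm)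
    also have "\<dots> = (\<Sum>m<N. ((\<i> * t) ^ m / fact m) * complex_of_real (\<integral>x. x ^ m * F x \<partial>lborel))"
      by (simp del: of_real_mult)
    finally show ?thesis using zero by simp
  qed
  moreover have "(\<lambda>N. \<integral>x. s N x \<partial>lborel) \<longlonglongrightarrow> (\<integral>x. F x *\<^sub>R iexp (t * x) \<partial>lborel)"
  proof (rule integral_dominated_convergence)
    show "integrable lborel (\<lambda>x. norm (exp (\<bar>t\<bar> * \<bar>x\<bar>) * F x))" using int[of "\<bar>t\<bar>"] by (rule integrable_norm)
    show "AE x in lborel. (\<lambda>N. s N x) \<longlonglongrightarrow> F x *\<^sub>R iexp (t * x)"
    proof (rule AE_I2)
      fix x
      have "(\<lambda>m. (\<i> * (t * x)) ^ m /\<^sub>R fact m * F x) sums (exp (\<i> * (t * x)) * F x)"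
        by (intro sums_mult2 exp_converges)
      then show "(\<lambda>N. s N x) \<longlonglongrightarrow> F x *\<^sub>R iexp (t * x)"
        unfolding s_def sums_def by (simp add: scaleR_conv_of_real mult.commute)
    qed
    show "AE x in lborel. norm (s N x) \<le> norm (exp (\<bar>t\<bar> * \<bar>x\<bar>) * F x)" for N
    proof (rule AE_I2)
      fix x
      have "norm (s N x) \<le> (\<Sum>m<N. norm ((\<i> * (t * x)) ^ m /\<^sub>R fact m * F x))"
        unfolding s_def by (rule norm_sum)
      also have "\<dots> = (\<Sum>m<N. (\<bar>t\<bar> * \<bar>x\<bar>) ^ m /\<^sub>R fact m) * \<bar>F x\<bar>"
        unfolding sum_distrib_right by (intro sum.cong) (auto simp: norm_mult norm_power abs_mult)
      also have "\<dots> \<le> exp (\<bar>t\<bar> * \<bar>x\<bar>) * \<bar>F x\<bar>"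
        unfolding exp_def by (intro mult_right_mono sum_le_suminf summable_exp_generic) auto
      finally show "norm (s N x) \<le> norm (exp (\<bar>t\<bar> * \<bar>x\<bar>) * F x)" by (simp add: abs_mult)
    qed
  qed (auto simp: s_def)
  ultimately show "(\<integral>x. F x *\<^sub>R iexp (t * x) \<partial>lborel) = 0"
    by (simp add: LIMSEQ_const_iff)
qed

text \<open>From 2t|x| \<le> 2t^2 + x^2/2, half of the Gaussian decay absorbs the exponential. By
  Cauchy-Schwarz this provides the exponential integrability required for moments of an L2
  function.\<close>

lemma exp_abs_gauss_square_integrable:
  "integrable lborel (\<lambda>x::real. (exp (t * \<bar>x\<bar>) * exp (- x\<^sup>2 / 2))\<^sup>2)"
proof (rule Bochner_Integration.integrable_bound)
  show "integrable lborel (\<lambda>x. exp (2 * t\<^sup>2) * gauss_poly 1 x)"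
    using integrable_gauss_poly by simp
  have "(exp (t * \<bar>x\<bar>) * exp (- x\<^sup>2 / 2))\<^sup>2 \<le> exp (2 * t\<^sup>2) * gauss_poly 1 x" for x :: real
  proof -
    have "2 * t * \<bar>x\<bar> \<le> 2 * t\<^sup>2 + x\<^sup>2 / 2"
      using sum_squares_bound[of "2 * t" "\<bar>x\<bar>"] by (simp add: power_mult_distrib)
    then have "2 * (t * \<bar>x\<bar> - x\<^sup>2 / 2) \<le> 2 * t\<^sup>2 + - x\<^sup>2 / 2"
      by (simp add: field_simps)
    then have "exp (2 * (t * \<bar>x\<bar> - x\<^sup>2 / 2)) \<le> exp (2 * t\<^sup>2 + - x\<^sup>2 / 2)" by simp
    moreover have "(exp (t * \<bar>x\<bar>) * exp (- x\<^sup>2 / 2))\<^sup>2 = exp (2 * (t * \<bar>x\<bar> - x\<^sup>2 / 2))"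
      by (simp add: power2_eq_square flip: exp_add)
    ultimately show ?thesis by (simp add: gauss_poly_def flip: exp_add)
  qed
  then show "AE x in lborel. norm ((exp (t * \<bar>x\<bar>) * exp (- x\<^sup>2 / 2))\<^sup>2) \<le> norm (exp (2 * t\<^sup>2) * gauss_poly 1 x)"
    by (auto simp: gauss_poly_def)
qed simp

text \<open>The scalar moment theorem is applied to each real component of exp(-x^2/2) f, and the
  positive weight is divided out.\<close>

lemma gauss_moment_complete:
  assumes G: "square_integrable f"
    and zero: "\<And>m. (\<integral>x. (x ^ m * exp (- x\<^sup>2 / 2)) *\<^sub>R f x \<partial>lborel) = 0"
  shows "AE x in lborel. f x = 0"
proof -
  have [measurable]: "f \<in> borel_measurable borel" using G by (simp add: square_integrable_def)
  have int: "integrable lborel (\<lambda>x. exp (t * \<bar>x\<bar>) *\<^sub>R exp (- x\<^sup>2 / 2) *\<^sub>R f x)" for t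
  proof (rule Bochner_Integration.integrable_bound)
    show "integrable lborel (\<lambda>x. (exp (t * \<bar>x\<bar>) * exp (- x\<^sup>2 / 2))\<^sup>2 + (norm (f x))\<^sup>2)"
      using G exp_abs_gauss_square_integrable by (simp add: square_integrable_def)
    have "h * y \<le> h\<^sup>2 + y\<^sup>2" if "y \<ge> 0" "h \<ge> 0" for h y :: real
      using sum_squares_bound[of h y] mult_nonneg_nonneg[OF that(2,1)] by linarith
    then show "AE x in lborel. norm (exp (t * \<bar>x\<bar>) *\<^sub>R exp (- x\<^sup>2 / 2) *\<^sub>R f x)
        \<le> norm ((exp (t * \<bar>x\<bar>) * exp (- x\<^sup>2 / 2))\<^sup>2 + (norm (f x))\<^sup>2)"
      by (intro AE_I2) simp
  qed simp
  have "AE x in lborel. f x \<bullet> v = 0" for v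
  proof -
    have "AE x in lborel. exp (- x\<^sup>2 / 2) * (f x \<bullet> v) = 0"
    proof (rule moments_zero_imp_zero)
      show "integrable lborel (\<lambda>x. exp (t * \<bar>x\<bar>) * (exp (- x\<^sup>2 / 2) * (f x \<bullet> v)))" for t
        using integrable_inner_left[OF int[of t], of v] by (simp add: mult.assoc)
      fix m
      define g where "g x = (x ^ m * exp (- x\<^sup>2 / 2)) *\<^sub>R f x" for x
      have "(\<integral>x. x ^ m * (exp (- x\<^sup>2 / 2) * (f x \<bullet> v)) \<partial>lborel) = (\<integral>x. g x \<bullet> v \<partial>lborel)"
        by (simp add: g_def mult.assoc)
      also have "\<dots> = (\<integral>x. g x \<partial>lborel) \<bullet> v"
      proof (cases "integrable lborel g")
        case True
        then show ?thesis by (rule integral_inner_left)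
      next
        case False
        have "integrable lborel g"
        proof (rule Bochner_Integration.integrable_bound)
          show "integrable lborel (\<lambda>x. (gauss_poly (monom 1 m) x)\<^sup>2 + (norm (f x))\<^sup>2)"
            using G integrable_gauss_poly_scaleR[of "gauss_poly (monom 1 m)" "monom 1 m"] bounded_gauss_poly
            by (simp add: square_integrable_def power2_eq_square)
          have "\<bar>h\<bar> * y \<le> h\<^sup>2 + y\<^sup>2" if "y \<ge> 0" for h y :: real
            using sum_squares_bound[of "\<bar>h\<bar>" y] mult_nonneg_nonneg[OF abs_ge_zero[of h] that]
            unfolding power2_abs by linarith
          from this[of "norm (f _)" "gauss_poly (monom 1 m) _"]
          show "AE x in lborel. norm (g x) \<le> norm ((gauss_poly (monom 1 m) x)\<^sup>2 + (norm (f x))\<^sup>2)"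
            by (intro AE_I2) (simp add: g_def gauss_poly_def poly_monom)
        qed (simp add: g_def[abs_def])
        with False show ?thesis by simp
      qed
      finally show "(\<integral>x. x ^ m * (exp (- x\<^sup>2 / 2) * (f x \<bullet> v)) \<partial>lborel) = 0"
        using zero[of m] by (simp add: g_def)
    qed simp
    then show ?thesis by eventually_elim simp
  qed
  then have "AE x in lborel. \<forall>v\<in>Basis. f x \<bullet> v = 0"
    by (intro AE_finite_allI) auto
  then show ?thesis by eventually_elim (simp add: euclidean_all_zero_iff)
qed

text \<open>Multiplication by x mixes only neighbouring Hermite functions, so induction on m, for
  all n at once, makes the integrals of x^m times any of them against f vanish. Level 0 is the
  Gaussian itself, which gives its moments.\<close>

lemma coef_zero_imp_zero:
  assumes "\<And>n. coef n u = 0"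
  shows "u = 0"
proof -
  obtain f where sq: "square_integrable f" and f: "u = abs_l2 f" by (rule l2_cases)
  have [measurable]: "f \<in> borel_measurable borel" using sq by (simp add: square_integrable_def)
  have coef0: "(\<integral>x. hermite_fun n x *\<^sub>R f x \<partial>lborel) = 0" for n
    using assms[of n] coef_abs[OF sq, of n] by (simp add: f)
  have int: "integrable lborel (\<lambda>x. (x ^ m * hermite_fun n x) *\<^sub>R f x)" for m n
  proof (induction m arbitrary: n)
    case 0
    then show ?case by (simp add: integrable_hermite_fun_scaleR sq)
  next
    case (Suc m)
    have "(x ^ Suc m * hermite_fun n x) *\<^sub>R f x = sqrt ((n + 1) / 2) *\<^sub>R ((x ^ m * hermite_fun (n + 1) x) *\<^sub>R f x)
       + sqrt (n / 2) *\<^sub>R ((x ^ m * hermite_fun (n - 1) x) *\<^sub>R f x)" for x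
    proof -
      have "x ^ Suc m * hermite_fun n x = x ^ m * (x * hermite_fun n x)" by simp
      then show ?thesis unfolding hermite_fun_mult_x by (simp add: algebra_simps)
    qed
    then show ?case using Suc by (simp del: power_Suc scaleR_scaleR)
  qed
  have mom: "(\<integral>x. (x ^ m * hermite_fun n x) *\<^sub>R f x \<partial>lborel) = 0" for m n
  proof (induction m arbitrary: n)
    case 0
    then show ?case by (simp add: coef0)
  next
    case (Suc m)
    have "(x ^ Suc m * hermite_fun n x) *\<^sub>R f x = sqrt ((n + 1) / 2) *\<^sub>R ((x ^ m * hermite_fun (n + 1) x) *\<^sub>R f x)
       + sqrt (n / 2) *\<^sub>R ((x ^ m * hermite_fun (n - 1) x) *\<^sub>R f x)" for x
    proof -
      have "x ^ Suc m * hermite_fun n x = x ^ m * (x * hermite_fun n x)" by simp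
      then show ?thesis unfolding hermite_fun_mult_x by (simp add: algebra_simps)
    qed
    then show ?case using Suc int by (simp del: power_Suc scaleR_scaleR)
  qed
  have "AE x in lborel. f x = 0"
  proof (rule gauss_moment_complete[OF sq])
    show "(\<integral>x. (x ^ m * exp (- x\<^sup>2 / 2)) *\<^sub>R f x \<partial>lborel) = 0" for m
      using mom[of m 0] by (simp add: hermite_fun_def gauss_poly_def)
  qed
  then show ?thesis
    unfolding f zero_l2_def using sq square_integrable_zero
    by (intro Quotient_rel_abs[OF Quotient_l2]) (simp add: l2_eq_def)
qed

section \<open>The operator in the Hermite basis\<close>

lemma matA_mult_nth: "(matA \<alpha> \<beta> *v v) $ 1 = of_real \<alpha> * v $ 1" "(matA \<alpha> \<beta> *v v) $ 2 = of_real \<beta> * v $ 2"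
  by (simp_all add: matA_def matrix_vector_mult_def sum_2 vector_def)

lemma matJ_mult_nth: "(matJ *v v) $ 1 = - v $ 2" "(matJ *v v) $ 2 = v $ 1"
  by (simp_all add: matJ_def matrix_vector_mult_def sum_2 vector_def)

lemma bounded_linear_matrix: "bounded_linear (\<lambda>v. (M :: complex^2^2) *v v)"
proof -
  have "linear (\<lambda>v. M *v v)"
    by (rule linearI) (simp_all add: vec_eq_iff matrix_vector_mult_def forall_2 sum_2 algebra_simps)
  then show ?thesis by (simp add: linear_conv_bounded_linear)
qed

text \<open>The second term carries a minus sign because \<open>x d/dx + 1/2\<close> is antisymmetric.\<close>

definition coef_op :: "real \<Rightarrow> real \<Rightarrow> (nat \<Rightarrow> complex^2) \<Rightarrow> nat \<Rightarrow> complex^2" where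
  "coef_op \<alpha> \<beta> c n = (n + 1/2) *\<^sub>R (matA \<alpha> \<beta> *v c n)
     - matJ *v ((if n < 2 then 0 else offdiag (n - 2) *\<^sub>R c (n - 2)) - offdiag n *\<^sub>R c (n + 2))"

text \<open>Integration by parts moves the derivatives from \<phi> to the Hermite function, where
  \<open>gauss_deriv2_hermite\<close> and \<open>dilation_hermite\<close> evaluate them.\<close>

lemma coef_ncho_expr:
  assumes "schwartz \<phi>"
  shows "coef n (abs_l2 (ncho_expr \<alpha> \<beta> \<phi>)) = coef_op \<alpha> \<beta> (\<lambda>m. coef m (abs_l2 \<phi>)) n"
proof -
  obtain D where D0: "D 0 = \<phi>"
    and D: "\<And>n x. (D n has_vector_derivative D (Suc n) x) (at x)"
    and bd: "\<And>m n. bounded (range (\<lambda>x. x ^ m *\<^sub>R D n x))"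
    using assms by (auto simp: schwartz_def)
  have cont: "continuous_on UNIV (D n)" for n
    by (meson D continuous_at_imp_continuous_on has_vector_derivative_continuous)
  have bdd: "bounded (range (D n))" for n using bd[of 0 n] by simp
  have meas: "D n \<in> borel_measurable borel" for n
    by (rule borel_measurable_continuous_onI[OF cont])
  have d: "vderiv (D n) = D (Suc n)" for n
    by (rule ext) (simp add: vderiv_def vector_derivative_at[OF D])
  \<comment> \<open>The pairing of a Gaussian polynomial with the k-th derivative of \<phi>;
    \<open>I_Suc\<close> lowers k at the cost of one \<open>gauss_deriv\<close>.\<close>
  define I where "I p k = (\<integral>x. gauss_poly p x *\<^sub>R D k x \<partial>lborel)" for p k
  have int: "integrable lborel (\<lambda>x. gauss_poly p x *\<^sub>R D k x)" for p k
    by (rule integrable_gauss_poly_scaleR[OF meas bdd])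
  have I_add: "I (p + q) k = I p k + I q k" for p q k
    unfolding I_def using int by (simp add: gauss_poly_add scaleR_add_left)
  have I_diff: "I (p - q) k = I p k - I q k" for p q k
    unfolding I_def using int by (simp add: gauss_poly_diff scaleR_diff_left)
  have I_smult: "I (smult c p) k = c *\<^sub>R I p k" for p c k
    unfolding I_def gauss_poly_smult by (simp flip: scaleR_scaleR)
  have I_0: "I 0 k = 0" for k using I_smult[of 0 0 k] by simp
  have I_Suc: "I p (Suc k) = - I (gauss_deriv p) k" for p k
    unfolding I_def by (rule gauss_poly_by_parts[OF D cont bdd bdd])
  have I_coef: "I (hermite_poly m) 0 = coef m (abs_l2 \<phi>)" for m
    using square_integrable_schwartz(1)[OF assms] by (simp add: coef_abs I_def hermite_fun_def D0)
  let ?h = "hermite_poly n"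
  have expr: "hermite_fun n x *\<^sub>R ncho_expr \<alpha> \<beta> \<phi> x =
     matA \<alpha> \<beta> *v ((- 1/2) *\<^sub>R (gauss_poly ?h x *\<^sub>R D 2 x) + (1/2) *\<^sub>R (gauss_poly (pCons 0 (pCons 0 ?h)) x *\<^sub>R D 0 x))
     + matJ *v (gauss_poly (pCons 0 ?h) x *\<^sub>R D 1 x + (1/2) *\<^sub>R (gauss_poly ?h x *\<^sub>R D 0 x))" for x
    by (simp add: ncho_expr_def d numeral_2_eq_2 hermite_fun_def gauss_poly_pCons_0 linear_simps[OF bounded_linear_matrix]
        algebra_simps power2_eq_square flip: D0)
  have "coef n (abs_l2 (ncho_expr \<alpha> \<beta> \<phi>)) = (\<integral>x. hermite_fun n x *\<^sub>R ncho_expr \<alpha> \<beta> \<phi> x \<partial>lborel)"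
    using square_integrable_schwartz(2)[OF assms] by (simp add: coef_abs)
  also have "\<dots> = (\<integral>x. matA \<alpha> \<beta> *v ((- 1/2) *\<^sub>R (gauss_poly ?h x *\<^sub>R D 2 x) + (1/2) *\<^sub>R (gauss_poly (pCons 0 (pCons 0 ?h)) x *\<^sub>R D 0 x)) \<partial>lborel)
     + (\<integral>x. matJ *v (gauss_poly (pCons 0 ?h) x *\<^sub>R D 1 x + (1/2) *\<^sub>R (gauss_poly ?h x *\<^sub>R D 0 x)) \<partial>lborel)"
    unfolding expr
    by (intro Bochner_Integration.integral_add integrable_bounded_linear[OF bounded_linear_matrix]
        Bochner_Integration.integrable_add integrable_scaleR_right int)
  also have "\<dots> = matA \<alpha> \<beta> *v (\<integral>x. (- 1/2) *\<^sub>R (gauss_poly ?h x *\<^sub>R D 2 x) + (1/2) *\<^sub>R (gauss_poly (pCons 0 (pCons 0 ?h)) x *\<^sub>R D 0 x) \<partial>lborel)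
     + matJ *v (\<integral>x. gauss_poly (pCons 0 ?h) x *\<^sub>R D 1 x + (1/2) *\<^sub>R (gauss_poly ?h x *\<^sub>R D 0 x) \<partial>lborel)"
    by (intro arg_cong2[where f = "(+)"] integral_bounded_linear[OF bounded_linear_matrix]
        Bochner_Integration.integrable_add integrable_scaleR_right int)
  also have "(\<integral>x. (- 1/2) *\<^sub>R (gauss_poly ?h x *\<^sub>R D 2 x) + (1/2) *\<^sub>R (gauss_poly (pCons 0 (pCons 0 ?h)) x *\<^sub>R D 0 x) \<partial>lborel)
     = (- 1/2) *\<^sub>R I ?h 2 + (1/2) *\<^sub>R I (pCons 0 (pCons 0 ?h)) 0"
    unfolding I_def
    by (simp only: Bochner_Integration.integral_add integrable_scaleR_right int integral_scaleR_right)
  also have "\<dots> = (n + 1/2) *\<^sub>R I ?h 0"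
    by (simp add: numeral_2_eq_2 I_Suc gauss_deriv2_hermite I_diff I_smult algebra_simps)
  also have "(\<integral>x. gauss_poly (pCons 0 ?h) x *\<^sub>R D 1 x + (1/2) *\<^sub>R (gauss_poly ?h x *\<^sub>R D 0 x) \<partial>lborel)
     = I (pCons 0 ?h) 1 + (1/2) *\<^sub>R I ?h 0"
    unfolding I_def
    by (simp only: Bochner_Integration.integral_add integrable_scaleR_right int integral_scaleR_right)
  also have "\<dots> = - I (pCons 0 (gauss_deriv ?h) + smult (1/2) ?h) 0"
    by (simp add: I_Suc gauss_deriv_pCons_0 I_add I_smult algebra_simps flip: scaleR_add_left)
  finally show ?thesis
    unfolding dilation_hermite I_diff I_smult if_distrib[of "\<lambda>p. I p 0"] I_0 I_coef coef_op_def
    by (simp add: linear_simps[OF bounded_linear_matrix] algebra_simps)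
qed

text \<open>Row n of the matrix contains finitely many continuous coefficient maps, so the relation
  defines a closed set. It contains the graph over Schwartz functions, hence its closure.\<close>

lemma coef_ncho:
  assumes "(u, w) \<in> ncho \<alpha> \<beta>"
  shows "coef n w = coef_op \<alpha> \<beta> (\<lambda>m. coef m u) n"
proof -
  have "closed {p. coef n (snd p) = coef_op \<alpha> \<beta> (\<lambda>m. coef m (fst p)) n}"
    unfolding coef_op_def
    by (intro closed_Collect_eq continuous_intros bounded_linear.continuous_on[OF bounded_linear_matrix]
        bounded_linear.continuous_on[OF bounded_linear_coef] continuous_on_If) 
      (cases "n < 2"; auto intro!: continuous_intros bounded_linear.continuous_on[OF bounded_linear_coef])
  then have "ncho \<alpha> \<beta> \<subseteq> {p. coef n (snd p) = coef_op \<alpha> \<beta> (\<lambda>m. coef m (fst p)) n}"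
    unfolding ncho_def by (intro closure_minimal) (auto simp: coef_ncho_expr)
  then show ?thesis using assms by auto
qed

lemma coef_ker:
  assumes "u \<in> ker_minus (ncho \<alpha> \<beta>) c"
  shows "c *s coef n u = coef_op \<alpha> \<beta> (\<lambda>m. coef m u) n"
  using coef_ncho[of u "scaleC c u" \<alpha> \<beta> n] assms by (simp add: ker_minus_def coef_scaleC)

section \<open>The graph over Schwartz functions before closing, and Hermite functions in it\<close>

definition ncho_core :: "real \<Rightarrow> real \<Rightarrow> (l2 \<times> l2) set" where
  "ncho_core \<alpha> \<beta> = {(abs_l2 \<phi>, abs_l2 (ncho_expr \<alpha> \<beta> \<phi>)) |\<phi>. schwartz \<phi>}"

lemma abs_l2_add:
  "square_integrable f \<Longrightarrow> square_integrable g \<Longrightarrow> abs_l2 (\<lambda>x. f x + g x) = abs_l2 f + abs_l2 g"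
  by (simp add: plus_l2.abs_eq l2_eq_refl)

lemma abs_l2_scaleR: "square_integrable f \<Longrightarrow> abs_l2 (\<lambda>x. r *\<^sub>R f x) = r *\<^sub>R abs_l2 f"
  by (simp add: scaleR_l2.abs_eq l2_eq_refl)

lemma schwartz_scaleR_add:
  assumes "schwartz \<phi>" "schwartz \<psi>"
  shows "schwartz (\<lambda>x. r *\<^sub>R \<phi> x + \<psi> x)"
    and "ncho_expr \<alpha> \<beta> (\<lambda>x. r *\<^sub>R \<phi> x + \<psi> x) = (\<lambda>x. r *\<^sub>R ncho_expr \<alpha> \<beta> \<phi> x + ncho_expr \<alpha> \<beta> \<psi> x)"
proof -
  obtain D where D0: "D 0 = \<phi>"
    and D: "\<And>n x. (D n has_vector_derivative D (Suc n) x) (at x)"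
    and bd: "\<And>m n. bounded (range (\<lambda>x. x ^ m *\<^sub>R D n x))"
    using assms(1) by (auto simp: schwartz_def)
  obtain D' where D'0: "D' 0 = \<psi>"
    and D': "\<And>n x. (D' n has_vector_derivative D' (Suc n) x) (at x)"
    and bd': "\<And>m n. bounded (range (\<lambda>x. x ^ m *\<^sub>R D' n x))"
    using assms(2) by (auto simp: schwartz_def)
  define S where "S n x = r *\<^sub>R D n x + D' n x" for n x
  have S: "(S n has_vector_derivative S (Suc n) x) (at x)" for n x
    unfolding S_def
    by (intro has_vector_derivative_add bounded_linear.has_vector_derivative[OF bounded_linear_scaleR_right] D D')
  have bS: "bounded (range (\<lambda>x. x ^ m *\<^sub>R S n x))" for m n
    using bounded_plus_comp[OF bounded_scaleR_comp[OF bd[of m n], of r] bd'[of m n]]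
    by (simp add: S_def scaleR_add_right mult.commute)
  have S0: "S 0 = (\<lambda>x. r *\<^sub>R \<phi> x + \<psi> x)" by (auto simp: S_def D0 D'0)
  show "schwartz (\<lambda>x. r *\<^sub>R \<phi> x + \<psi> x)"
    unfolding schwartz_def using S bS S0 by blast
  have d: "vderiv (D n) = D (Suc n)" "vderiv (D' n) = D' (Suc n)" "vderiv (S n) = S (Suc n)" for n
    by (auto simp: vderiv_def fun_eq_iff intro!: vector_derivative_at D D' S)
  have "ncho_expr \<alpha> \<beta> (S 0) x = r *\<^sub>R ncho_expr \<alpha> \<beta> (D 0) x + ncho_expr \<alpha> \<beta> (D' 0) x" for x
    unfolding ncho_expr_def d
    by (simp add: S_def linear_simps[OF bounded_linear_matrix] algebra_simps)
  then show "ncho_expr \<alpha> \<beta> (\<lambda>x. r *\<^sub>R \<phi> x + \<psi> x) = (\<lambda>x. r *\<^sub>R ncho_expr \<alpha> \<beta> \<phi> x + ncho_expr \<alpha> \<beta> \<psi> x)"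
    unfolding S0 D0 D'0 by (intro ext)
qed

lemma ncho_core_scaleR_add:
  assumes "p \<in> ncho_core \<alpha> \<beta>" "q \<in> ncho_core \<alpha> \<beta>"
  shows "r *\<^sub>R p + q \<in> ncho_core \<alpha> \<beta>"
proof -
  obtain \<phi> \<psi> where \<phi>: "schwartz \<phi>" "p = (abs_l2 \<phi>, abs_l2 (ncho_expr \<alpha> \<beta> \<phi>))"
    and \<psi>: "schwartz \<psi>" "q = (abs_l2 \<psi>, abs_l2 (ncho_expr \<alpha> \<beta> \<psi>))"
    using assms by (auto simp: ncho_core_def)
  have "r *\<^sub>R p + q = (abs_l2 (\<lambda>x. r *\<^sub>R \<phi> x + \<psi> x), abs_l2 (ncho_expr \<alpha> \<beta> (\<lambda>x. r *\<^sub>R \<phi> x + \<psi> x)))"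
    unfolding schwartz_scaleR_add(2)[OF \<phi>(1) \<psi>(1)] \<phi>(2) \<psi>(2)
    by (simp add: abs_l2_add abs_l2_scaleR square_integrable_scaleR square_integrable_schwartz \<phi>(1) \<psi>(1))
  then show ?thesis
    using schwartz_scaleR_add(1)[OF \<phi>(1) \<psi>(1)] by (auto simp: ncho_core_def)
qed

lemma subspace_ncho_core: "subspace (ncho_core \<alpha> \<beta>)"
proof -
  have s0: "schwartz (\<lambda>x. 0)"
    using schwartz_gauss_poly[of 0 0] by (simp add: gauss_poly_def)
  have "0 \<in> ncho_core \<alpha> \<beta>"
  proof -
    have v: "vderiv (\<lambda>x. 0) = (\<lambda>x. 0)" by (simp add: vderiv_def fun_eq_iff)
    have "ncho_expr \<alpha> \<beta> (\<lambda>x. 0) = (\<lambda>x. 0)"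
      unfolding ncho_expr_def v by simp
    then show ?thesis using s0 unfolding ncho_core_def zero_prod_def zero_l2_def by force
  qed
  then show ?thesis
    unfolding subspace_def
    using ncho_core_scaleR_add[of _ \<alpha> \<beta> _ 1] ncho_core_scaleR_add[of _ \<alpha> \<beta> 0] by fastforce
qed

text \<open>These are the columns of the matrix whose rows appear in \<open>coef_op\<close>, which
  is why the J terms carry the opposite signs.\<close>

lemma basis_mem_ncho_core:
  "(basis n v, (n + 1/2) *\<^sub>R basis n (matA \<alpha> \<beta> *v v) +
     ((if n < 2 then 0 else offdiag (n - 2) *\<^sub>R basis (n - 2) (matJ *v v))
       - offdiag n *\<^sub>R basis (n + 2) (matJ *v v))) \<in> ncho_core \<alpha> \<beta>"
proof -
  let ?h = "hermite_poly n"
  define \<phi> where "\<phi> x = hermite_fun n x *\<^sub>R v" for x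
  have sch: "schwartz \<phi>" unfolding \<phi>_def hermite_fun_def by (rule schwartz_gauss_poly)
  have vd: "vderiv (\<lambda>x. gauss_poly p x *\<^sub>R v) = (\<lambda>x. gauss_poly (gauss_deriv p) x *\<^sub>R v)" for p
  proof
    fix x
    show "vderiv (\<lambda>x. gauss_poly p x *\<^sub>R v) x = gauss_poly (gauss_deriv p) x *\<^sub>R v"
      using has_vector_derivative_scaleR[OF gauss_poly_has_real_derivative[of p x]
        has_vector_derivative_const[of v]]
      unfolding vderiv_def by (intro vector_derivative_at) simp
  qed
  have lo: "gauss_poly (if n < 2 then 0 else smult (offdiag (n - 2)) (hermite_poly (n - 2))) x
     = (if n < 2 then 0 else offdiag (n - 2) * hermite_fun (n - 2) x)" for x
    by (simp add: gauss_poly_smult hermite_fun_def) (simp add: gauss_poly_def)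
  have e: "ncho_expr \<alpha> \<beta> \<phi> x = (n + 1/2) *\<^sub>R (hermite_fun n x *\<^sub>R (matA \<alpha> \<beta> *v v)) + 
    ((if n < 2 then 0 else offdiag (n - 2)) *\<^sub>R (hermite_fun (n - 2) x *\<^sub>R (matJ *v v)) 
       + (- offdiag n) *\<^sub>R (hermite_fun (n + 2) x *\<^sub>R (matJ *v v)))" for x
  proof -
    have 1: "- (1/2) *\<^sub>R vderiv (vderiv \<phi>) x + (1/2 * x\<^sup>2) *\<^sub>R \<phi> x = ((n + 1/2) * hermite_fun n x) *\<^sub>R v"
      unfolding \<phi>_def hermite_fun_def vd gauss_deriv2_hermite gauss_poly_diff gauss_poly_smult gauss_poly_pCons_0
      by (simp add: algebra_simps power2_eq_square flip: scaleR_add_left)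
    have "x *\<^sub>R vderiv \<phi> x + (1/2) *\<^sub>R \<phi> x = gauss_poly (pCons 0 (gauss_deriv ?h) + smult (1/2) ?h) x *\<^sub>R v"
      unfolding \<phi>_def hermite_fun_def vd gauss_poly_add gauss_poly_smult gauss_poly_pCons_0
      by (simp add: algebra_simps)
    also have "\<dots> = ((if n < 2 then 0 else offdiag (n - 2) * hermite_fun (n - 2) x) - offdiag n * hermite_fun (n + 2) x) *\<^sub>R v"
      unfolding dilation_hermite gauss_poly_diff lo gauss_poly_smult hermite_fun_def ..
    finally have 2: "x *\<^sub>R vderiv \<phi> x + (1/2) *\<^sub>R \<phi> x = \<dots>" .
    show ?thesis
      unfolding ncho_expr_def 1 2 by (simp add: linear_simps[OF bounded_linear_matrix] algebra_simps)
  qed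
  have "abs_l2 (ncho_expr \<alpha> \<beta> \<phi>) = (n + 1/2) *\<^sub>R basis n (matA \<alpha> \<beta> *v v) +
    ((if n < 2 then 0 else offdiag (n - 2)) *\<^sub>R basis (n - 2) (matJ *v v) + (- offdiag n) *\<^sub>R basis (n + 2) (matJ *v v))"
    unfolding e basis_def
    by (simp only: abs_l2_add abs_l2_scaleR square_integrable_add square_integrable_scaleR square_integrable_hermite)
  then have "abs_l2 (ncho_expr \<alpha> \<beta> \<phi>) = (n + 1/2) *\<^sub>R basis n (matA \<alpha> \<beta> *v v) +
     ((if n < 2 then 0 else offdiag (n - 2) *\<^sub>R basis (n - 2) (matJ *v v))
       - offdiag n *\<^sub>R basis (n + 2) (matJ *v v))"
    by (simp split: if_splits)
  moreover have "abs_l2 \<phi> = basis n v" by (simp add: basis_def \<phi>_def[abs_def])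
  ultimately show ?thesis
    using sch unfolding ncho_core_def by force
qed

section \<open>Absolutely convergent series\<close>

lemma weighted_sum_square_le:
  fixes a c :: "nat \<Rightarrow> real"
  assumes "\<And>k. c k > 0"
  shows "(\<Sum>k\<in>A. a k)\<^sup>2 \<le> (\<Sum>k\<in>A. c k) * (\<Sum>k\<in>A. (a k)\<^sup>2 / c k)"
proof -
  have "(\<Sum>k\<in>A. sqrt (c k) * (a k / sqrt (c k)))\<^sup>2 \<le> (\<Sum>k\<in>A. (sqrt (c k))\<^sup>2) * (\<Sum>k\<in>A. (a k / sqrt (c k))\<^sup>2)"
    by (rule Cauchy_Schwarz_ineq_sum)
  moreover have "sqrt (c k) \<noteq> 0" "0 \<le> c k" for k using assms[of k] by auto
  ultimately show ?thesis by (simp add: power_divide)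
qed

lemma norm_abs_l2_square:
  "square_integrable f \<Longrightarrow> (norm (abs_l2 f))\<^sup>2 = (\<integral>x. (norm (f x))\<^sup>2 \<partial>lborel)"
  by (simp add: power2_norm_eq_inner inner_l2.abs_eq l2_eq_refl)

lemma abs_l2_sum:
  assumes "finite A" "\<And>k. k \<in> A \<Longrightarrow> square_integrable (f k)"
  shows "square_integrable (\<lambda>x. \<Sum>k\<in>A. f k x) \<and> abs_l2 (\<lambda>x. \<Sum>k\<in>A. f k x) = (\<Sum>k\<in>A. abs_l2 (f k))"
  using assms
proof (induction rule: finite_induct)
  case empty
  then show ?case by (simp add: square_integrable_zero zero_l2_def)
next
  case (insert a A)
  then show ?case
    by (simp add: square_integrable_add plus_l2.abs_eq l2_eq_refl flip: plus_l2.abs_eq)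
qed

lemma abs_l2_diff:
  "square_integrable f \<Longrightarrow> square_integrable g \<Longrightarrow> abs_l2 (\<lambda>x. f x - g x) = abs_l2 f - abs_l2 g"
  by (simp add: minus_l2.abs_eq l2_eq_refl)

text \<open>The weights \<open>c k\<close> turn the bound on the norms into an integrable bound on
  \<open>(\<Sum>k. norm (f k x))\<^sup>2\<close> via Cauchy--Schwarz.\<close>

lemma summable_norm_l2:
  fixes a :: "nat \<Rightarrow> l2"
  assumes "summable (\<lambda>k. norm (a k))"
  shows "\<exists>u. (\<lambda>N. \<Sum>k<N. a k) \<longlonglongrightarrow> u"
proof -
  have "\<exists>f. \<forall>k. square_integrable (f k) \<and> a k = abs_l2 (f k)"
    by (rule choice) (metis l2_cases)
  then obtain f where sq: "\<And>k. square_integrable (f k)" and a: "\<And>k. a k = abs_l2 (f k)" by auto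
  have [measurable]: "f k \<in> borel_measurable borel" for k
    using sq[of k] by (simp add: square_integrable_def)
  \<comment> \<open>The summand (1/2)^k keeps the weight positive when a k = 0, without spoiling
    summability.\<close>
  define c where "c k = norm (a k) + (1/2) ^ k" for k
  have c: "c k > 0" for k unfolding c_def by (simp add: add_nonneg_pos)
  have sumc: "summable c" unfolding c_def by (intro summable_add assms summable_geometric) simp
  define C where "C = suminf c"
  have C: "(\<Sum>k<N. c k) \<le> C" for N
    unfolding C_def using c by (intro sum_le_suminf sumc) (auto intro: less_imp_le)
  have C0: "0 \<le> C" using C[of 0] by simp
  define g where "g k x = (norm (f k x))\<^sup>2 / c k" for k x
  have g0: "0 \<le> g k x" for k x using c[of k] by (simp add: g_def)
  have gint: "integrable lborel (g k)" for k
    unfolding g_def using sq[of k] by (auto simp: square_integrable_def)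
  have gI: "(\<integral>x. g k x \<partial>lborel) \<le> c k" for k
  proof -
    have "(\<integral>x. g k x \<partial>lborel) = (norm (a k))\<^sup>2 / c k"
      unfolding g_def a norm_abs_l2_square[OF sq] by simp
    also have "\<dots> \<le> c k"
      using c[of k] power_mono[of "norm (a k)" "c k" 2] by (simp add: c_def field_simps power2_eq_square)
    finally show ?thesis .
  qed
  \<comment> \<open>The sum is first taken in the extended reals, where summability is not an issue;
    finiteness of its integral then yields pointwise summability almost everywhere.\<close>
  define G where "G x = (\<Sum>k. ennreal (g k x))" for x
  have "(\<integral>\<^sup>+x. G x \<partial>lborel) = (\<Sum>k. \<integral>\<^sup>+x. ennreal (g k x) \<partial>lborel)"
    unfolding G_def by (rule nn_integral_suminf) (simp add: g_def)
  also have "\<dots> \<le> (\<Sum>k. ennreal (c k))"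
    using gI by (intro suminf_le) (auto simp: nn_integral_eq_integral[OF gint] g0 intro: ennreal_leI)
  also have "\<dots> = ennreal C"
    unfolding C_def using c by (intro suminf_ennreal2 sumc) (auto intro: less_imp_le)
  finally have GC: "(\<integral>\<^sup>+x. G x \<partial>lborel) \<le> ennreal C" .
  have "AE x in lborel. G x \<noteq> \<infinity>"
    using GC by (intro nn_integral_PInf_AE) (auto simp: G_def g_def top_unique)
  then have sumg: "AE x in lborel. summable (\<lambda>k. g k x)"
    by eventually_elim (auto simp: G_def g0 intro: summable_suminf_not_top)
  have intg: "integrable lborel (\<lambda>x. \<Sum>k. g k x)"
    by (rule integrable_suminf[OF gint])
      (use sumg gI g0 in \<open>auto intro: summable_comparison_test'[OF sumc]\<close>)
  have sumn: "AE x in lborel. summable (\<lambda>k. norm (f k x)) \<and> (\<Sum>k. norm (f k x))\<^sup>2 \<le> C * (\<Sum>k. g k x)"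
    using sumg
  proof eventually_elim
    case (elim x)
    have b: "(\<Sum>k<N. norm (f k x))\<^sup>2 \<le> C * (\<Sum>k. g k x)" for N
    proof -
      have "(\<Sum>k<N. norm (f k x))\<^sup>2 \<le> (\<Sum>k<N. c k) * (\<Sum>k<N. g k x)"
        unfolding g_def by (rule weighted_sum_square_le[OF c])
      also have "\<dots> \<le> C * (\<Sum>k. g k x)"
        using C0 C elim g0 by (intro mult_mono sum_le_suminf sum_nonneg) auto
      finally show ?thesis .
    qed
    have S: "summable (\<lambda>k. norm (f k x))"
      by (rule summableI_nonneg_bounded[where x = "sqrt (C * (\<Sum>k. g k x))"])
        (use b real_le_rsqrt in auto)
    have "(\<lambda>N. (\<Sum>k<N. norm (f k x))\<^sup>2) \<longlonglongrightarrow> (\<Sum>k. norm (f k x))\<^sup>2"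
      by (intro tendsto_power summable_LIMSEQ S)
    then have "(\<Sum>k. norm (f k x))\<^sup>2 \<le> C * (\<Sum>k. g k x)"
      by (rule LIMSEQ_le_const2) (use b in auto)
    with S show ?case by simp
  qed
  define F where "F x = (\<Sum>k. f k x)" for x
  have Fm [measurable]: "F \<in> borel_measurable borel" unfolding F_def by measurable
  have intCg: "integrable lborel (\<lambda>x. C * (\<Sum>k. g k x))" using intg by simp
  \<comment> \<open>One integrable function dominates the squared tails for all N, which is what
    dominated convergence in norm requires.\<close>
  have bound: "AE x in lborel. (\<forall>N. (norm (F x - (\<Sum>k<N. f k x)))\<^sup>2 \<le> C * (\<Sum>k. g k x))
     \<and> (\<lambda>N. (norm (F x - (\<Sum>k<N. f k x)))\<^sup>2) \<longlonglongrightarrow> 0"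
    using sumn
  proof eventually_elim
    case (elim x)
    then have S: "summable (\<lambda>k. norm (f k x))" by simp
    have tail: "norm (F x - (\<Sum>k<N. f k x)) \<le> (\<Sum>k. norm (f k x))" for N
    proof -
      have "F x - (\<Sum>k<N. f k x) = (\<Sum>k. f (k + N) x)"
        unfolding F_def using suminf_minus_initial_segment[OF summable_norm_cancel[OF S], of N] by simp
      also have "norm \<dots> \<le> (\<Sum>k. norm (f (k + N) x))"
        by (rule summable_norm) (use S summable_ignore_initial_segment in blast)
      also have "\<dots> \<le> (\<Sum>k. norm (f k x))"
        using suminf_minus_initial_segment[OF S, of N] sum_nonneg[of "{..<N}" "\<lambda>k. norm (f k x)"] by simp
      finally show ?thesis .
    qed
    have "(norm (F x - (\<Sum>k<N. f k x)))\<^sup>2 \<le> C * (\<Sum>k. g k x)" for N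
      using power_mono[OF tail norm_ge_zero, of N 2] elim by linarith
    moreover have "(\<lambda>N. (norm (F x - (\<Sum>k<N. f k x)))\<^sup>2) \<longlonglongrightarrow> (norm (F x - F x))\<^sup>2"
      unfolding F_def by (intro tendsto_intros summable_LIMSEQ summable_norm_cancel[OF S])
    ultimately show ?case by simp
  qed
  have sqF: "square_integrable F"
    unfolding square_integrable_def
  proof
    show "integrable lborel (\<lambda>x. (norm (F x))\<^sup>2)"
    proof (rule Bochner_Integration.integrable_bound[OF intCg])
      show "AE x in lborel. norm ((norm (F x))\<^sup>2) \<le> norm (C * (\<Sum>k. g k x))"
        using bound
      proof eventually_elim
        case (elim x)
        then have "(norm (F x - (\<Sum>k<0. f k x)))\<^sup>2 \<le> C * (\<Sum>k. g k x)" by blast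
        then show ?case by simp
      qed
    qed simp
  qed simp
  have sqs: "square_integrable (\<lambda>x. \<Sum>k<N. f k x)" and abss: "(\<Sum>k<N. a k) = abs_l2 (\<lambda>x. \<Sum>k<N. f k x)" for N
    using abs_l2_sum[of "{..<N}" f] sq a by simp_all
  have "(\<lambda>N. \<integral>x. (norm (F x - (\<Sum>k<N. f k x)))\<^sup>2 \<partial>lborel) \<longlonglongrightarrow> (\<integral>x. 0 \<partial>(lborel :: real measure))"
    by (rule integral_dominated_convergence[OF _ _ intCg]) (use bound in \<open>auto elim: eventually_mono\<close>)
  then have "(\<lambda>N. (norm (abs_l2 F - (\<Sum>k<N. a k)))\<^sup>2) \<longlonglongrightarrow> 0"
    unfolding abss abs_l2_diff[OF sqF sqs, symmetric] norm_abs_l2_square[OF square_integrable_diff[OF sqF sqs]] by simp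
  then have "(\<lambda>N. sqrt ((norm (abs_l2 F - (\<Sum>k<N. a k)))\<^sup>2)) \<longlonglongrightarrow> sqrt 0"
    by (rule tendsto_real_sqrt)
  then have "(\<lambda>N. norm ((\<Sum>k<N. a k) - abs_l2 F)) \<longlonglongrightarrow> 0" by (simp add: norm_minus_commute)
  then have "(\<lambda>N. (\<Sum>k<N. a k)) \<longlonglongrightarrow> abs_l2 F"
    using LIM_zero_iff tendsto_norm_zero_iff by blast
  then show ?thesis by blast
qed

section \<open>Three-term recurrences\<close>

lemma offdiag_pos: "offdiag n > 0"
  by (simp add: offdiag_def)

text \<open>The geometric mean of n + 1 and n + 2 is at most their arithmetic mean.\<close>

lemma offdiag_le: "offdiag n \<le> (n + 3/2) / 2"
proof -
  have "sqrt ((real n + 1) * (real n + 2)) \<le> sqrt ((n + 3/2)\<^sup>2)"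
    by (intro real_sqrt_le_mono) (simp add: power2_eq_square algebra_simps)
  then show ?thesis by (simp add: offdiag_def)
qed

text \<open>If y does not decrease from k to k + 1, the term b k * y k is absorbed by b k * y (k +
  1), and what is left of the diagonal forces growth by the factor 3/2. The non-decrease thus
  propagates, and boundedness leaves only zero.\<close>

lemma geometric_growth_bounded_imp_zero:
  fixes y b :: "nat \<Rightarrow> real"
  assumes nonneg: "\<And>k. 0 \<le> y k" and bdd: "\<And>k. y k \<le> B"
    and b: "\<And>k. 0 < b k"
    and rec: "\<And>k. (b k + 3/2 * b (k + 1)) * y (k + 1) - b k * y k \<le> b (k + 1) * y (k + 2)"
    and start: "y 0 \<le> y 1"
  shows "y 1 = 0"
proof -
  have "y k \<le> y (k + 1) \<and> (3/2) ^ k * y 1 \<le> y (k + 1)" for k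
  proof (induction k)
    case 0
    then show ?case using start by simp
  next
    case (Suc k)
    have "b k * y k \<le> b k * y (k + 1)" using Suc b[of k] by (intro mult_left_mono) auto
    then have "b (k + 1) * (3/2 * y (k + 1)) \<le> b (k + 1) * y (k + 2)"
      using rec[of k] by (simp add: algebra_simps)
    then have "3/2 * y (k + 1) \<le> y (k + 2)" using b[of "k + 1"] by simp
    moreover have "y (k + 1) \<le> 3/2 * y (k + 1)" using nonneg[of "k + 1"] by simp
    ultimately show ?case using Suc by auto
  qed
  then have le: "(3/2) ^ k * y 1 \<le> B" for k using bdd order_trans by blast
  show ?thesis
  proof (rule ccontr)
    assume "y 1 \<noteq> 0"
    then have pos: "y 1 > 0" using nonneg[of 1] by simp
    obtain k where "B / y 1 < (3/2 :: real) ^ k" using real_arch_pow[of "3/2" "B / y 1"] by auto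
    then show False using le[of k] pos by (simp add: field_simps)
  qed
qed

text \<open>The eigenvalue equation of the Jacobi matrix with diagonal \<open>d\<close> and off-diagonal \<open>-b\<close>.\<close>

fun jacobi_sol :: "(nat \<Rightarrow> real) \<Rightarrow> (nat \<Rightarrow> real) \<Rightarrow> real \<Rightarrow> nat \<Rightarrow> real" where
  "jacobi_sol d b l 0 = 1"
| "jacobi_sol d b l (Suc 0) = (d 0 - l) / b 0"
| "jacobi_sol d b l (Suc (Suc k)) = ((d (Suc k) - l) * jacobi_sol d b l (Suc k) - b k * jacobi_sol d b l k) / b (Suc k)"

lemma continuous_jacobi_sol: "isCont (\<lambda>l. jacobi_sol d b l k) l"
proof -
  have "continuous_on UNIV (\<lambda>l. jacobi_sol d b l k)"
    by (induction k rule: induct_nat_012) (auto simp: divide_inverse intro!: continuous_intros)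
  then show ?thesis by (simp add: continuous_on_eq_continuous_at)
qed

text \<open>Shooting: \<open>L\<close> is the supremum of the parameters for which the solution stays positive. If the
  solution at \<open>L\<close> ever failed to decrease, it would grow from there on, also for slightly larger parameters.\<close>

lemma decaying_jacobi_sol:
  fixes d b :: "nat \<Rightarrow> real"
  assumes b: "\<And>k. 0 < b k" and start: "b 0 \<le> d 0"
    and gap: "\<And>k. 2 * b k + b (k + 1) \<le> d (k + 1) - d 0"
  obtains L p where "0 \<le> L" "L < d 0" "p 0 = 1"
    and "\<And>k. b k * p (k + 1) = (d k - L) * p k - (if k = 0 then 0 else b (k - 1) * p (k - 1))"
    and "\<And>k. 0 < p k \<and> p k \<le> (1/2) ^ k"
proof -
  define P where "P = jacobi_sol d b"
  have P0: "P l 0 = 1" for l by (simp add: P_def)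
  have P1: "b 0 * P l 1 = d 0 - l" for l using b[of 0] by (simp add: P_def)
  have P2: "b (k + 1) * P l (k + 2) = (d (k + 1) - l) * P l (k + 1) - b k * P l k" for l k
    using b[of "Suc k"] by (simp add: P_def)
  have cont: "((\<lambda>l. P l k) \<longlongrightarrow> P l k) (at l)" for l k
    using continuous_jacobi_sol unfolding P_def isCont_def by blast
  \<comment> \<open>The gap contains 2 * b k although one b k would absorb the previous entry; the
    surplus makes the inequality strict.\<close>
  have step: "P l (k + 1) < P l (k + 2)"
    if "l \<le> d 0" "0 < P l k" "P l k \<le> P l (k + 1)" for l k
  proof -
    have "b k * P l k \<le> b k * P l (k + 1)" using that b[of k] by (intro mult_left_mono) auto
    moreover have "(2 * b k + b (k + 1)) * P l (k + 1) \<le> (d (k + 1) - l) * P l (k + 1)"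
      using that gap[of k] by (intro mult_right_mono) auto
    moreover have "0 < b k * P l (k + 1)" using that b[of k] by auto
    ultimately have "b (k + 1) * P l (k + 1) < b (k + 1) * P l (k + 2)"
      unfolding P2 by (simp add: algebra_simps)
    then show ?thesis using b[of "k + 1"] by simp
  qed
  have grow: "0 < P l (k + j) \<and> P l (k + j) \<le> P l (k + j + 1)"
    if "l \<le> d 0" "0 < P l k" "P l k \<le> P l (k + 1)" for l k j
  proof (induction j)
    case 0
    then show ?case using that by simp
  next
    case (Suc j)
    then show ?case using step[of l "k + j"] that by auto
  qed
  define S where "S = {l. 0 \<le> l \<and> l \<le> d 0 \<and> (\<forall>k. 0 < P l k)}"
  have d0: "0 < d 0" using b[of 0] start by linarith
  have "P 0 0 \<le> P 0 1" using P1[of 0] P0[of 0] start b[of 0]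
    by (metis diff_zero mult.right_neutral mult_le_cancel_left_pos)
  then have "0 \<in> S" using grow[of 0 0] d0 P0[of 0] by (auto simp: S_def)
  have bddS: "bdd_above S" by (auto simp: S_def intro: bdd_aboveI[of _ "d 0"])
  define L where "L = Sup S"
  have L0: "0 \<le> L" unfolding L_def by (rule cSup_upper[OF \<open>0 \<in> S\<close> bddS])
  have Ld: "L \<le> d 0" unfolding L_def using \<open>0 \<in> S\<close> by (intro cSup_least) (auto simp: S_def)
  have "0 \<le> P L k" for k
  proof (rule ccontr)
    assume "\<not> 0 \<le> P L k"
    then have "P L k < 0" by simp
    then have "\<forall>\<^sub>F l in at L. P l k < 0" using cont order_tendstoD(2) by blast
    then obtain e where e: "e > 0" "\<And>l. l \<noteq> L \<Longrightarrow> dist l L < e \<Longrightarrow> P l k < 0"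
      unfolding eventually_at by blast
    obtain l where l: "l \<in> S" "L - e < l"
      using less_cSup_iff[OF _ bddS, of "L - e"] \<open>0 \<in> S\<close> e(1) unfolding L_def by auto
    moreover have "l \<le> L" unfolding L_def by (rule cSup_upper[OF l(1) bddS])
    ultimately have "P l k < 0" using e \<open>P L k < 0\<close> by (cases "l = L") (auto simp: dist_real_def)
    moreover have "0 < P l k" using l(1) by (simp add: S_def)
    ultimately show False by simp
  qed
  note nonneg = this
  \<comment> \<open>A zero after a positive entry would make the following entry negative.\<close>
  have pos: "0 < P L k" for k
  proof (induction k)
    case 0
    then show ?case by (simp add: P0)
  next
    case (Suc k)
    show ?case
    proof (rule ccontr)
      assume "\<not> 0 < P L (Suc k)"
      then have "P L (k + 1) = 0" using nonneg[of "Suc k"] by simp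
      then have "b (k + 1) * P L (k + 2) < 0" unfolding P2 using Suc b[of k] by simp
      then show False using nonneg[of "k + 2"] b[of "k + 1"] by (simp add: mult_less_0_iff)
    qed
  qed
  have Ld': "L < d 0"
    using P1[of L] pos[of 1] b[of 0] mult_pos_pos by fastforce
  have decr: "P L (k + 1) < P L k" for k
  proof (rule ccontr)
    assume "\<not> P L (k + 1) < P L k"
    \<comment> \<open>Moving one index up makes the inequality strict, hence open in the parameter.
      It then persists for some l > L, where growth keeps all entries positive and puts l into
      S.\<close>
    then have "P L (k + 1) < P L (k + 2)" using step[of L k] Ld pos by simp
    then have "\<forall>\<^sub>F l in at L. 0 < P l (k + 2) - P l (k + 1)"
      by (intro order_tendstoD(1)[OF tendsto_diff[OF cont cont]]) simp
    moreover have "\<forall>\<^sub>F l in at L. \<forall>j\<in>{..k + 1}. 0 < P l j"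
      by (intro eventually_ball_finite ballI order_tendstoD(1)[OF cont] pos) simp
    moreover have "\<forall>\<^sub>F l in at L. l < d 0"
      by (rule order_tendstoD(2)[OF tendsto_ident_at Ld'])
    ultimately have "\<forall>\<^sub>F l in at L. l < d 0 \<and> 0 < P l (k + 2) - P l (k + 1) \<and> (\<forall>j\<in>{..k + 1}. 0 < P l j)"
      by eventually_elim simp
    then have "\<forall>\<^sub>F l in at_right L. l < d 0 \<and> 0 < P l (k + 2) - P l (k + 1) \<and> (\<forall>j\<in>{..k + 1}. 0 < P l j)"
      by (simp add: eventually_at_split)
    moreover have "\<forall>\<^sub>F l in at_right L. L < l" by (simp add: eventually_at_filter)
    ultimately have "\<forall>\<^sub>F l in at_right L. L < l \<and> l < d 0 \<and> P l (k + 1) < P l (k + 2) \<and> (\<forall>j\<in>{..k + 1}. 0 < P l j)"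
      by eventually_elim simp
    then obtain l where l: "L < l" "l < d 0" "P l (k + 1) < P l (k + 2)" "\<forall>j\<in>{..k + 1}. 0 < P l j"
      using eventually_happens[of _ "at_right L"] by (auto simp: trivial_limit_at_right_real)
    have "0 < P l j" for j
    proof (cases "j \<le> k + 1")
      case False
      then obtain i where "j = k + 1 + i" using le_Suc_ex nat_le_linear by blast
      then show ?thesis using grow[of l "k + 1" i] l by auto
    qed (use l in auto)
    then have "l \<in> S" using l L0 by (auto simp: S_def)
    then have "l \<le> L" unfolding L_def by (rule cSup_upper[OF _ bddS])
    then show False using l by simp
  qed
  \<comment> \<open>Because the sequence decreases, the term with index k + 2 costs at most b (k +
    1) of the gap, and the remaining 2 * b k gives the factor 1/2.\<close>
  have half: "P L (k + 1) \<le> P L k / 2" for k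
  proof -
    have "(2 * b k + b (k + 1)) * P L (k + 1) \<le> (d (k + 1) - L) * P L (k + 1)"
      using pos[of "k + 1"] gap[of k] Ld by (intro mult_right_mono) auto
    moreover have "b (k + 1) * P L (k + 2) \<le> b (k + 1) * P L (k + 1)"
      using decr[of "k + 1"] b[of "k + 1"] by (intro mult_left_mono) (auto simp: less_imp_le)
    ultimately have "b k * (2 * P L (k + 1)) \<le> b k * P L k"
      unfolding P2 by (simp add: algebra_simps)
    then show ?thesis using b[of k] by simp
  qed
  have "P L k \<le> (1/2) ^ k" for k
  proof (induction k)
    case (Suc k)
    then show ?case using half[of k] by simp
  qed (simp add: P0)
  moreover have "b k * P L (k + 1) = (d k - L) * P L k - (if k = 0 then 0 else b (k - 1) * P L (k - 1))" for k
    using P1[of L] P2[of "k - 1" L] P0[of L] by (cases k) auto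
  ultimately show ?thesis
    using that[of L "P L"] L0 Ld' pos P0 by blast
qed

text \<open>X and Y are read alternately at every second index, which turns the coupled inequalities
  into one scalar recurrence. Their symmetric roles allow both kinds of chain to be treated by
  exchanging them.\<close>

lemma alternating_chain_vanish:
  fixes X Y :: "nat \<Rightarrow> real"
  assumes nonneg: "\<And>n. 0 \<le> X n" "\<And>n. 0 \<le> Y n" and bdd: "\<And>n. X n \<le> B" "\<And>n. Y n \<le> B"
    and XY: "\<And>n. 2 * (n + 2) * X (n + 2) - offdiag n * Y n \<le> offdiag (n + 2) * Y (n + 4)"
    and YX: "\<And>n. 2 * (n + 2) * Y (n + 2) - offdiag n * X n \<le> offdiag (n + 2) * X (n + 4)"
    and start: "X m \<le> Y (m + 2)"
  shows "Y (m + 2) = 0"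
proof -
  define y where "y k = (if even k then X else Y) (m + 2 * k)" for k
  have "y 1 = 0"
  proof (rule geometric_growth_bounded_imp_zero[where b = "\<lambda>k. offdiag (m + 2 * k)" and B = B])
    fix k
    show "0 \<le> y k" "y k \<le> B" "0 < offdiag (m + 2 * k)"
      using nonneg bdd by (auto simp: y_def offdiag_pos)
    define n where "n = m + 2 * k"
    have n: "m + 2 * (k + 1) = n + 2" "m + 2 * (k + 2) = n + 4" by (simp_all add: n_def)
    have y0: "y k = (if even k then X else Y) n" by (simp add: y_def n_def)
    have y1: "y (k + 1) = (if even k then Y else X) (n + 2)" unfolding y_def n by simp
    have y2: "y (k + 2) = (if even k then X else Y) (n + 4)" unfolding y_def n by simp
    note y = y0 y1 y2
    \<comment> \<open>The bounds on \<open>offdiag\<close> give at most 5n/4 + 27/8 on the left;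
      this is where the growth factor 3/2 fits.\<close>
    have "offdiag n + 3/2 * offdiag (n + 2) \<le> 2 * (n + 2)"
      using offdiag_le[of n] offdiag_le[of "n + 2"] by simp
    then have "(offdiag n + 3/2 * offdiag (n + 2)) * y (k + 1) \<le> 2 * (n + 2) * y (k + 1)"
      unfolding y1 using nonneg by (intro mult_right_mono) auto
    moreover have "2 * (n + 2) * y (k + 1) - offdiag n * y k \<le> offdiag (n + 2) * y (k + 2)"
      using XY[of n] YX[of n] unfolding y by (simp add: add.commute)
    ultimately show "(offdiag (m + 2 * k) + 3/2 * offdiag (m + 2 * (k + 1))) * y (k + 1) - offdiag (m + 2 * k) * y k
        \<le> offdiag (m + 2 * (k + 1)) * y (k + 2)"
      by (simp add: n_def algebra_simps)
  qed (use start in \<open>auto simp: y_def\<close>)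
  then show ?thesis by (simp add: y_def)
qed

section \<open>The lowest eigenvalue\<close>

lemma basis_scaleR: "basis n (r *\<^sub>R v) = r *\<^sub>R basis n v"
  unfolding basis_def by (subst abs_l2_scaleR[symmetric, OF square_integrable_hermite]) (simp add: mult.commute)

lemma basis_minus: "basis n (- v) = - basis n v"
  using basis_scaleR[of n "-1" v] by simp

text \<open>Rotating by \<open>J\<close> at every step gives all off-diagonal entries of the chain the same sign.\<close>

fun chain_vec :: "nat \<Rightarrow> complex^2" where
  "chain_vec 0 = axis 1 1"
| "chain_vec (Suc k) = matJ *v chain_vec k"

lemma matJ_matJ: "matJ *v (matJ *v v) = - v"
  by (simp add: vec_eq_iff forall_2 matJ_mult_nth)

lemma norm_matJ: "norm (matJ *v v) = norm v"
  by (simp add: norm_vec_def L2_set_def sum_2 matJ_mult_nth)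

lemma norm_chain_vec: "norm (chain_vec k) = 1"
proof (induction k)
  case 0
  show ?case by (simp add: norm_vec_def L2_set_def sum_2 axis_def)
qed (simp add: norm_matJ)

lemma matA_chain_vec: "matA \<alpha> \<beta> *v chain_vec k = (if even k then \<alpha> else \<beta>) *\<^sub>R chain_vec k"
proof -
  have "(even k \<longrightarrow> chain_vec k $ 2 = 0) \<and> (odd k \<longrightarrow> chain_vec k $ 1 = 0)"
    by (induction k) (simp_all add: matJ_mult_nth axis_def)
  then show ?thesis
    by (auto simp: vec_eq_iff forall_2 matA_mult_nth scaleR_conv_of_real[where 'a = complex])
qed

definition chain_diag :: "real \<Rightarrow> real \<Rightarrow> nat \<Rightarrow> real" where
  "chain_diag \<alpha> \<beta> k = (2 * k + 1/2) * (if even k then \<alpha> else \<beta>)"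

definition chain_basis :: "nat \<Rightarrow> l2" where
  "chain_basis k = basis (2 * k) (chain_vec k)"

lemma chain_basis_mem_ncho_core:
  "(chain_basis k, chain_diag \<alpha> \<beta> k *\<^sub>R chain_basis k
     - (if k = 0 then 0 else offdiag (2 * (k - 1)) *\<^sub>R chain_basis (k - 1))
     - offdiag (2 * k) *\<^sub>R chain_basis (k + 1)) \<in> ncho_core \<alpha> \<beta>"
proof -
  have diag: "(real (2 * k) + 1/2) *\<^sub>R basis (2 * k) (matA \<alpha> \<beta> *v chain_vec k)
      = chain_diag \<alpha> \<beta> k *\<^sub>R chain_basis k"
    unfolding matA_chain_vec basis_scaleR by (simp add: chain_diag_def chain_basis_def)
  have low: "(if 2 * k < 2 then 0 else offdiag (2 * k - 2) *\<^sub>R basis (2 * k - 2) (matJ *v chain_vec k))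
      = - (if k = 0 then 0 else offdiag (2 * (k - 1)) *\<^sub>R chain_basis (k - 1))"
    by (cases k) (simp_all add: chain_basis_def matJ_matJ basis_minus)
  have up: "basis (2 * k + 2) (matJ *v chain_vec k) = chain_basis (k + 1)"
    by (simp add: chain_basis_def)
  show ?thesis
    using basis_mem_ncho_core[of "2 * k" "chain_vec k" \<alpha> \<beta>]
    unfolding diag low up chain_basis_def[symmetric]
    by (simp only: diff_conv_add_uminus add.assoc)
qed

lemma hermite_inner_0_left: "n > 0 \<Longrightarrow> hermite_inner 0 n = 0"
  using hermite_inner_0 by (simp add: hermite_inner_def mult.commute[of "hermite_fun 0 _"])

text \<open>On truncated sums the operator acts as multiplication by L up to two boundary terms. The
  off-diagonal entries grow linearly while p decays geometrically, so these terms vanish in the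
  limit and the pair lies in the closed graph.\<close>

lemma chain_eigenvector:
  assumes rec: "\<And>k. offdiag (2 * k) * p (k + 1) =
      (chain_diag \<alpha> \<beta> k - L) * p k - (if k = 0 then 0 else offdiag (2 * (k - 1)) * p (k - 1))"
    and p0: "p 0 = 1" and decay: "\<And>k. 0 < p k \<and> p k \<le> (1/2) ^ k"
  shows "\<exists>u. u \<noteq> 0 \<and> (u, L *\<^sub>R u) \<in> ncho \<alpha> \<beta>"
proof -
  let ?E = chain_basis and ?b = "\<lambda>k. offdiag (2 * k)"
  define Q where "Q k = chain_diag \<alpha> \<beta> k *\<^sub>R ?E k - (if k = 0 then 0 else ?b (k - 1) *\<^sub>R ?E (k - 1)) - ?b k *\<^sub>R ?E (k + 1)" for k
  have Q: "(?E k, Q k) \<in> ncho_core \<alpha> \<beta>" for k unfolding Q_def by (rule chain_basis_mem_ncho_core)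
  define K where "K = sqrt (hermite_inner 0 0)"
  have normE: "norm (?E k) = K" for k by (simp add: chain_basis_def norm_basis norm_chain_vec K_def)
  have K0: "K > 0" using hermite_inner_0_0_pos by (simp add: K_def)
  have "summable (\<lambda>k. norm (p k *\<^sub>R ?E k))"
  proof (rule summable_comparison_test')
    show "summable (\<lambda>k. (1/2) ^ k * K)" by (intro summable_mult2 summable_geometric) simp
    show "norm (norm (p k *\<^sub>R ?E k)) \<le> (1/2) ^ k * K" for k
      using decay[of k] K0 by (simp add: normE mult_right_mono)
  qed
  then obtain u where u: "(\<lambda>N. \<Sum>k<N. p k *\<^sub>R ?E k) \<longlonglongrightarrow> u" using summable_norm_l2[of "\<lambda>k. p k *\<^sub>R ?E k"] by auto
  define s where "s N = (\<Sum>k<Suc N. p k *\<^sub>R ?E k)" for N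
  have s: "s \<longlonglongrightarrow> u" unfolding s_def using u by (rule LIMSEQ_Suc)
  \<comment> \<open>The recurrence cancels every interior coefficient; only the two entries across
    the cut between N and N + 1 survive.\<close>
  have Qs: "(\<Sum>k<Suc N. p k *\<^sub>R Q k) = L *\<^sub>R s N + ((?b N * p (N + 1)) *\<^sub>R ?E N - (?b N * p N) *\<^sub>R ?E (N + 1))" for N
  proof (induction N)
    case 0
    show ?case using rec[of 0] p0 by (simp add: s_def Q_def algebra_simps flip: scaleR_add_left)
  next
    case (Suc N)
    have "?b (N + 1) * p (N + 2) = chain_diag \<alpha> \<beta> (N + 1) * p (N + 1) - L * p (N + 1) - ?b N * p N"
      using rec[of "N + 1"] by (simp add: algebra_simps)
    then have "(?b (N + 1) * p (N + 2)) *\<^sub>R ?E (N + 1) = (chain_diag \<alpha> \<beta> (N + 1) * p (N + 1)) *\<^sub>R ?E (N + 1)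
       - (L * p (N + 1)) *\<^sub>R ?E (N + 1) - (?b N * p N) *\<^sub>R ?E (N + 1)"
      by (simp only: scaleR_diff_left)
    moreover have "s (Suc N) = s N + p (N + 1) *\<^sub>R ?E (N + 1)" by (simp add: s_def)
    ultimately show ?case using Suc by (simp add: Q_def algebra_simps)
  qed
  have lim_p: "(\<lambda>k. ?b k * p k) \<longlonglongrightarrow> 0" "(\<lambda>k. ?b k * p (k + 1)) \<longlonglongrightarrow> 0"
  proof -
    have lim: "(\<lambda>k. (real (2 * k) + 3/2) / 2 * (1/2) ^ k) \<longlonglongrightarrow> 0" by real_asymp
    have bnd: "\<bar>?b k * q\<bar> \<le> (real (2 * k) + 3/2) / 2 * (1/2) ^ k" if "0 < q" "q \<le> (1/2) ^ k" for k q
    proof -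
      have "?b k * q \<le> (real (2 * k) + 3/2) / 2 * (1/2) ^ k"
        using that offdiag_le[of "2 * k"] by (intro mult_mono) auto
      then show ?thesis using that offdiag_pos[of "2 * k"] by simp
    qed
    show "(\<lambda>k. ?b k * p k) \<longlonglongrightarrow> 0"
      by (rule Lim_null_comparison[OF _ lim]) (use bnd decay in auto)
    have "p (k + 1) \<le> (1/2) ^ k" for k
      using decay[of "k + 1"] zero_le_power[of "1/2 :: real" k] by simp
    then show "(\<lambda>k. ?b k * p (k + 1)) \<longlonglongrightarrow> 0"
      by (intro Lim_null_comparison[OF _ lim] always_eventually allI) (use bnd decay in auto)
  qed
  have E0: "(\<lambda>k. c k *\<^sub>R ?E (h k)) \<longlonglongrightarrow> 0" if "c \<longlonglongrightarrow> 0" for c h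
  proof (rule tendsto_norm_zero_cancel)
    show "(\<lambda>k. norm (c k *\<^sub>R ?E (h k))) \<longlonglongrightarrow> 0"
      using tendsto_mult_right[OF tendsto_norm[OF that], of K] by (simp add: normE)
  qed
  have "(\<lambda>N. \<Sum>k<Suc N. p k *\<^sub>R Q k) \<longlonglongrightarrow> L *\<^sub>R u + (0 - 0)"
    unfolding Qs by (intro tendsto_intros s E0 lim_p)
  then have lim: "(\<lambda>N. (s N, \<Sum>k<Suc N. p k *\<^sub>R Q k)) \<longlonglongrightarrow> (u, L *\<^sub>R u)"
    by (intro tendsto_Pair s) simp
  have "(s N, \<Sum>k<Suc N. p k *\<^sub>R Q k) \<in> ncho_core \<alpha> \<beta>" for N
  proof -
    have "(\<Sum>k<Suc N. p k *\<^sub>R (?E k, Q k)) \<in> ncho_core \<alpha> \<beta>"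
      using subspace_ncho_core Q by (intro subspace_sum subspace_scale)
    then show ?thesis by (simp add: s_def sum_prod scaleR_prod_def fst_sum snd_sum prod_eq_iff)
  qed
  then have mem: "(u, L *\<^sub>R u) \<in> ncho \<alpha> \<beta>"
    using lim unfolding ncho_def ncho_core_def[symmetric] closure_sequential
    by (intro exI[of _ "\<lambda>N. (s N, \<Sum>k<Suc N. p k *\<^sub>R Q k)"]) simp
  \<comment> \<open>The limit is nonzero because its coefficient at level 0 comes from p 0 = 1
    alone.\<close>
  have "coef 0 (s N) = hermite_inner 0 0 *\<^sub>R chain_vec 0" for N
  proof (induction N)
    case 0
    then show ?case by (simp add: s_def p0 chain_basis_def coef_basis)
  next
    case (Suc N)
    have "s (Suc N) = s N + p (Suc N) *\<^sub>R ?E (Suc N)" by (simp add: s_def)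
    then show ?case
      using Suc by (simp add: coef_add coef_scaleR chain_basis_def coef_basis hermite_inner_0_left)
  qed
  moreover have "(\<lambda>N. coef 0 (s N)) \<longlonglongrightarrow> coef 0 u"
    by (rule bounded_linear.tendsto[OF bounded_linear_coef s])
  ultimately have "coef 0 u = hermite_inner 0 0 *\<^sub>R chain_vec 0"
    by (simp add: LIMSEQ_const_iff)
  then have "coef 0 u \<noteq> 0"
    using hermite_inner_0_0_pos by (simp add: axis_eq_0_iff)
  then have "u \<noteq> 0" by (metis coef_scaleR scaleR_zero_left)
  with mem show ?thesis by blast
qed

lemma scaleC_of_real: "scaleC (of_real r) u = r *\<^sub>R u"
  by transfer (auto simp: l2_eq_def scaleR_eq_vector_smult square_integrable_smult)

text \<open>The first diagonal entry of the chain is \<alpha>/2, so L < d 0 is the desired bound.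
  The diagonal rises above it by at least (2k + 2)\<alpha> \<ge> 4k + 4, whereas the gap condition
  asks for at most 3k + 13/4.\<close>

lemma ncho_eigenvalue_le:
  assumes "2 < \<alpha>" "\<alpha> < \<beta>"
  shows "\<exists>\<mu>. \<mu> < \<alpha> / 2 \<and> eigenvalue (ncho \<alpha> \<beta>) (of_real \<mu>)"
proof (rule decaying_jacobi_sol[where b = "\<lambda>k. offdiag (2 * k)" and d = "chain_diag \<alpha> \<beta>"])
  show "0 < offdiag (2 * k)" for k by (rule offdiag_pos)
  show "offdiag (2 * 0) \<le> chain_diag \<alpha> \<beta> 0"
    using offdiag_le[of 0] assms by (simp add: chain_diag_def)
  fix k :: nat
  have "\<alpha> \<le> (if even (k + 1) then \<alpha> else \<beta>)" using assms by simp
  then have "(2 * real (k + 1) + 1/2) * \<alpha> \<le> chain_diag \<alpha> \<beta> (k + 1)"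
    unfolding chain_diag_def by (intro mult_left_mono) auto
  moreover have "(2 * real k + 2) * 2 \<le> (2 * real k + 2) * \<alpha>"
    using assms by (intro mult_left_mono) auto
  ultimately show "2 * offdiag (2 * k) + offdiag (2 * (k + 1)) \<le> chain_diag \<alpha> \<beta> (k + 1) - chain_diag \<alpha> \<beta> 0"
    using offdiag_le[of "2 * k"] offdiag_le[of "2 * (k + 1)"] by (simp add: chain_diag_def[of _ _ 0] algebra_simps)
next
  fix L p
  assume "L < chain_diag \<alpha> \<beta> 0" and p: "p 0 = 1"
    "\<And>k. offdiag (2 * k) * p (k + 1) = (chain_diag \<alpha> \<beta> k - L) * p k - (if k = 0 then 0 else offdiag (2 * (k - 1)) * p (k - 1))"
    "\<And>k. 0 < p k \<and> p k \<le> (1/2) ^ k"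
  then have "L < \<alpha> / 2" by (simp add: chain_diag_def)
  moreover have "eigenvalue (ncho \<alpha> \<beta>) (of_real L)"
    using chain_eigenvector[OF p(2,1,3)] by (auto simp: eigenvalue_def ker_minus_def scaleC_of_real)
  ultimately show ?thesis by blast
qed

section \<open>Coefficients of an eigenfunction: moduli, growth and determination by two
  levels\<close>

lemma coef_op_nth:
  "coef_op \<alpha> \<beta> c n $ 1 = of_real ((n + 1/2) * \<alpha>) * c n $ 1
     + (if n < 2 then 0 else of_real (offdiag (n - 2)) * c (n - 2) $ 2) - of_real (offdiag n) * c (n + 2) $ 2"
  "coef_op \<alpha> \<beta> c n $ 2 = of_real ((n + 1/2) * \<beta>) * c n $ 2
     - (if n < 2 then 0 else of_real (offdiag (n - 2)) * c (n - 2) $ 1) + of_real (offdiag n) * c (n + 2) $ 1"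
  by (simp_all add: coef_op_def matA_mult_nth matJ_mult_nth scaleR_conv_of_real[where 'a = complex] algebra_simps)

text \<open>Passing to moduli removes the signs and phases. The factor s is the sign in which the
  rows of the two components differ.\<close>

lemma norm_three_term:
  fixes x y z :: complex
  assumes "of_real a * x + y = s * of_real b * z" "norm s = 1"
  shows "a * norm x - norm y \<le> \<bar>b\<bar> * norm z"
proof -
  have "a * norm x \<le> norm (of_real a * x)" by (simp add: norm_mult mult_right_mono)
  also have "\<dots> \<le> norm (of_real a * x + y) + norm y"
    using norm_triangle_ineq4[of "of_real a * x + y" y] by simp
  finally show ?thesis using assms by (simp add: norm_mult)
qed

lemma bounded_coef_eigen:
  assumes "2 < \<alpha>" "\<alpha> < \<beta>" "E \<le> \<alpha> / 2" "1 / (\<beta> / 2 - E) \<le> \<alpha>"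
    and eq: "\<And>n. of_real E *s c n = coef_op \<alpha> \<beta> c n" and bdd: "\<And>n. norm (c n) \<le> B"
  shows "c 0 $ 2 = 0" "c 1 = 0"
proof -
  define X where "X n = norm (c n $ 1)" for n
  define Y where "Y n = norm (c n $ 2)" for n
  have nonneg: "0 \<le> X n" "0 \<le> Y n" for n by (auto simp: X_def Y_def)
  have bd: "X n \<le> B" "Y n \<le> B" for n
    unfolding X_def Y_def by (rule order_trans[OF Finite_Cartesian_Product.norm_nth_le bdd])+
  have eq1: "of_real E * c n $ 1 = coef_op \<alpha> \<beta> c n $ 1" and eq2: "of_real E * c n $ 2 = coef_op \<alpha> \<beta> c n $ 2" for n
    using eq[of n] by (metis vector_smult_component)+
  have ineqX: "((n + 1/2) * \<alpha> - E) * X n - (if n < 2 then 0 else offdiag (n - 2) * Y (n - 2)) \<le> offdiag n * Y (n + 2)" for n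
  proof -
    have "of_real ((n + 1/2) * \<alpha> - E) * c n $ 1 + (if n < 2 then 0 else of_real (offdiag (n - 2)) * c (n - 2) $ 2)
        = 1 * of_real (offdiag n) * c (n + 2) $ 2"
      using eq1[of n] unfolding coef_op_nth by (simp add: algebra_simps)
    from norm_three_term[OF this] show ?thesis
      using offdiag_pos[of n] offdiag_pos[of "n - 2"] by (auto simp: X_def Y_def norm_mult split: if_splits)
  qed
  have ineqY: "((n + 1/2) * \<beta> - E) * Y n - (if n < 2 then 0 else offdiag (n - 2) * X (n - 2)) \<le> offdiag n * X (n + 2)" for n
  proof -
    have "of_real ((n + 1/2) * \<beta> - E) * c n $ 2 + (if n < 2 then 0 else - of_real (offdiag (n - 2)) * c (n - 2) $ 1)
        = (- 1) * of_real (offdiag n) * c (n + 2) $ 1"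
      using eq2[of n] unfolding coef_op_nth by (simp add: algebra_simps split: if_splits)
    from norm_three_term[OF this] show ?thesis
      using offdiag_pos[of n] offdiag_pos[of "n - 2"] by (auto simp: X_def Y_def norm_mult split: if_splits)
  qed
  \<comment> \<open>Since E \<le> \<alpha>/2, the constant halves of the diagonal pay for E, leaving
    n\<alpha> or n\<beta>, both at least 2n.\<close>
  have diag: "2 * n \<le> (n + 1/2) * \<alpha> - E" "2 * n \<le> (n + 1/2) * \<beta> - E" for n :: nat
  proof -
    have "2 * n \<le> n * \<alpha>" "n * \<alpha> \<le> n * \<beta>" 
      using assms(1,2) mult_left_mono[of 2 \<alpha> "real n"] mult_left_mono[of \<alpha> \<beta> "real n"] by auto
    then show "2 * n \<le> (n + 1/2) * \<alpha> - E" "2 * n \<le> (n + 1/2) * \<beta> - E"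
      using assms(1-3) by (simp_all add: algebra_simps)
  qed
  have XY: "2 * (n + 2) * X (n + 2) - offdiag n * Y n \<le> offdiag (n + 2) * Y (n + 4)" for n
  proof -
    have "n + 2 + 2 = n + 4" by simp
    from ineqX[of "n + 2", unfolded this] mult_right_mono[OF diag(1)[of "n + 2"] nonneg(1)[of "n + 2"]]
    show ?thesis by (simp add: algebra_simps)
  qed
  have YX: "2 * (n + 2) * Y (n + 2) - offdiag n * X n \<le> offdiag (n + 2) * X (n + 4)" for n
  proof -
    have "n + 2 + 2 = n + 4" by simp
    from ineqY[of "n + 2", unfolded this] mult_right_mono[OF diag(2)[of "n + 2"] nonneg(2)[of "n + 2"]]
    show ?thesis by (simp add: algebra_simps)
  qed
  note vanish_XY = alternating_chain_vanish[OF nonneg bd XY YX]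
    and vanish_YX = alternating_chain_vanish[OF nonneg(2,1) bd(2,1) YX XY]
  have od1: "offdiag 1 \<le> 5/4" using offdiag_le[of 1] by simp
  \<comment> \<open>At n = 1 there is no lower neighbour, and the diagonal is at least 2 against an
    off-diagonal entry of at most 5/4.\<close>
  have start1: "X 1 \<le> Y 3" "Y 1 \<le> X 3"
  proof -
    have "offdiag 1 * X 1 \<le> offdiag 1 * Y 3"
    proof -
      have "offdiag 1 * X 1 \<le> 2 * X 1" using od1 nonneg by (intro mult_right_mono) auto
      also have "\<dots> \<le> ((1 + 1/2) * \<alpha> - E) * X 1" using diag(1)[of 1] nonneg by (intro mult_right_mono) auto
      finally show ?thesis using ineqX[of 1] by (simp add: numeral_3_eq_3)
    qed
    then show "X 1 \<le> Y 3" using offdiag_pos[of 1] by simp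
    have "offdiag 1 * Y 1 \<le> offdiag 1 * X 3"
    proof -
      have "offdiag 1 * Y 1 \<le> 2 * Y 1" using od1 nonneg by (intro mult_right_mono) auto
      also have "\<dots> \<le> ((1 + 1/2) * \<beta> - E) * Y 1" using diag(2)[of 1] nonneg by (intro mult_right_mono) auto
      finally show ?thesis using ineqY[of 1] by (simp add: numeral_3_eq_3)
    qed
    then show "Y 1 \<le> X 3" using offdiag_pos[of 1] by simp
  qed
  have "X 1 = 0" "Y 1 = 0"
    using vanish_XY[of 1] vanish_YX[of 1] start1 nonneg(1)[of 1] nonneg(2)[of 1] by (simp_all add: numeral_3_eq_3)
  then show "c 1 = 0" by (simp add: X_def Y_def vec_eq_iff forall_2)
  define \<delta> where "\<delta> = \<beta> / 2 - E"
  have \<delta>: "0 < \<delta>" using assms(2,3) by (simp add: \<delta>_def)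
  \<comment> \<open>Row 0 ties g_0 to f_2 exactly. If \<delta> is below \<open>offdiag 0\<close>, a
    nonzero g_0 exceeds f_2 in modulus, so growth cannot be started here.\<close>
  have eq0: "\<delta> * Y 0 = offdiag 0 * X 2"
  proof -
    have "of_real \<delta> * c 0 $ 2 = - of_real (offdiag 0) * c 2 $ 1"
      using eq2[of 0] unfolding coef_op_nth by (simp add: \<delta>_def algebra_simps eq_neg_iff_add_eq_0 numeral_2_eq_2)
    then have "norm (of_real \<delta> * c 0 $ 2) = norm (- of_real (offdiag 0) * c 2 $ 1)" by simp
    then show ?thesis using \<delta> offdiag_pos[of 0] by (simp add: norm_mult X_def Y_def)
  qed
  \<comment> \<open>Growth is started one step later. Since the square of \<open>offdiag 0\<close>
    is 1/2, the coupling to g_0 costs X 2 / (2\<delta>), at most \<alpha>/2 times X 2. The diagonal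
    is at least 2\<alpha>, and the remaining 3\<alpha>/2 exceeds \<open>offdiag 2\<close>.\<close>
  have "X 2 \<le> Y (2 + 2)"
  proof -
    have od0: "offdiag 0 * offdiag 0 = 1/2" by (simp add: offdiag_def)
    have "offdiag 0 * Y 0 = (1 / \<delta>) * (offdiag 0 * (\<delta> * Y 0))" using \<delta> by simp
    also have "offdiag 0 * (\<delta> * Y 0) = 1/2 * X 2"
      unfolding eq0 by (simp only: od0 flip: mult.assoc)
    also have "(1 / \<delta>) * (1/2 * X 2) \<le> \<alpha> * (1/2 * X 2)"
      using assms(4) nonneg(1)[of 2] by (intro mult_right_mono) (auto simp: \<delta>_def)
    finally have 1: "offdiag 0 * Y 0 \<le> \<alpha> / 2 * X 2" by simp
    have 2: "2 * \<alpha> * X 2 \<le> ((2 + 1/2) * \<alpha> - E) * X 2"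
      using assms(3) nonneg by (intro mult_right_mono) auto
    have "offdiag 2 * X 2 \<le> 3/2 * \<alpha> * X 2"
      using offdiag_le[of 2] assms(1) nonneg by (intro mult_right_mono) auto
    also have "\<dots> \<le> offdiag 2 * Y (2 + 2)"
      using ineqX[of 2] 1 2 by (simp add: algebra_simps)
    finally show ?thesis using offdiag_pos[of 2] by simp
  qed
  moreover from this have "Y (2 + 2) = 0" by (rule vanish_XY)
  ultimately have "X 2 = 0" using nonneg(1)[of 2] by simp
  then have "Y 0 = 0" using eq0 \<delta> by simp
  then show "c 0 $ 2 = 0" by (simp add: Y_def)
qed

text \<open>Row m of the equation determines the coefficient at m + 2 from those at m and m - 2,
  because \<open>offdiag m\<close> is nonzero. It serves both to see that f_0 is nonzero and to
  compare two eigenvectors.\<close>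

lemma coef_eigen_zero:
  assumes eq: "\<And>n. e *s c n = coef_op \<alpha> \<beta> c n" and "c 0 = 0" "c 1 = 0"
  shows "c n = 0"
proof (induction n rule: less_induct)
  case (less n)
  show ?case
  proof (cases "n < 2")
    case True
    then have "n = 0 \<or> n = 1" by auto
    then show ?thesis using assms by auto
  next
    case False
    define m where "m = n - 2"
    have n: "n = m + 2" using False by (simp add: m_def)
    have z: "c m = 0" "c (m - 2) = 0" using less.IH n by auto
    have "(e *s c m) $ 1 = coef_op \<alpha> \<beta> c m $ 1" "(e *s c m) $ 2 = coef_op \<alpha> \<beta> c m $ 2" using eq by auto
    then show ?thesis
      using offdiag_pos[of m] unfolding coef_op_nth n by (auto simp: z vec_eq_iff forall_2 split: if_splits)
  qed
qed

lemma coef_op_diff_smult: "coef_op \<alpha> \<beta> (\<lambda>n. c n - t *s d n) n = coef_op \<alpha> \<beta> c n - t *s coef_op \<alpha> \<beta> d n"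
  by (simp add: vec_eq_iff forall_2 coef_op_nth algebra_simps)

theorem theorem1p2:
  fixes \<alpha> \<beta> E :: real
  assumes "\<beta> > \<alpha>" and "\<alpha> > 2"
    and "lowest_eigenvalue (ncho \<alpha> \<beta>) E"
    and "1/2 > (1/2 * \<beta> - E) powi (-2) * (1 / (\<alpha>\<^sup>2 - 1)) + 1 / (\<alpha>\<^sup>2 - 1)"
  shows "l2.dim (ker_minus (ncho \<alpha> \<beta>) (of_real E)) = 1"
proof -
  let ?V = "ker_minus (ncho \<alpha> \<beta>) (of_real E)"
  have E: "E \<le> \<alpha> / 2"
    using ncho_eigenvalue_le[of \<alpha> \<beta>] assms(1-3) unfolding lowest_eigenvalue_def by force
  \<comment> \<open>Multiplied by \<alpha>^2 - 1 > 0, the hypothesis says r^2 + 1 < (\<alpha>^2 -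
    1)/2 for the inverse r of \<beta>/2 - E, so r^2 is below \<alpha>^2.\<close>
  have inv: "1 / (\<beta> / 2 - E) \<le> \<alpha>"
  proof -
    define r where "r = 1 / (\<beta> / 2 - E)"
    have "\<alpha>\<^sup>2 > 2\<^sup>2" using assms(2) by (intro power_strict_mono) auto
    then have a: "\<alpha>\<^sup>2 - 1 > 0" by simp
    have "(1/2 * \<beta> - E) powi (-2) = r\<^sup>2"
      by (simp add: r_def power_int_minus power_divide field_simps)
    then have "(r\<^sup>2 + 1) / (\<alpha>\<^sup>2 - 1) < 1/2" using assms(4) by (simp add: add_divide_distrib)
    then have "r\<^sup>2 + 1 < (\<alpha>\<^sup>2 - 1) / 2" using a by (simp add: field_simps)
    then have "r\<^sup>2 \<le> \<alpha>\<^sup>2" using zero_le_power2[of \<alpha>] by argo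
    then have "r \<le> \<alpha>" by (rule power2_le_imp_le) (use assms(2) in simp)
    then show ?thesis by (simp add: r_def)
  qed
  have low: "coef 0 v $ 2 = 0" "coef 1 v = 0" if v: "v \<in> ?V" for v
  proof -
    have "norm (coef n v) \<le> sqrt (hermite_inner 0 0) * norm v" for n by (rule norm_coef_le)
    from bounded_coef_eigen[OF assms(2,1) E inv coef_ker[OF v] this]
    show "coef 0 v $ 2 = 0" "coef 1 v = 0" by auto
  qed
  obtain u where u: "u \<in> ?V" "u \<noteq> 0"
    using assms(3) by (auto simp: lowest_eigenvalue_def eigenvalue_def)
  have u01: "coef 0 u $ 1 \<noteq> 0"
  proof
    assume "coef 0 u $ 1 = 0"
    then have "coef 0 u = 0" using low(1)[OF u(1)] by (simp add: vec_eq_iff forall_2)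
    then have "coef n u = 0" for n
      using coef_eigen_zero[OF coef_ker[OF u(1)]] low(2)[OF u(1)] by simp
    then show False using coef_zero_imp_zero u(2) by blast
  qed
  have "v \<in> l2.span {u}" if v: "v \<in> ?V" for v
  proof -
    \<comment> \<open>Chosen so that v - t u has no f_0 component; all other coefficients at levels
      0 and 1 vanish by \<open>low\<close>.\<close>
    define t where "t = coef 0 v $ 1 / coef 0 u $ 1"
    define c where "c n = coef n v - t *s coef n u" for n
    have "c n = 0" for n
    proof (rule coef_eigen_zero)
      show "complex_of_real E *s c n = coef_op \<alpha> \<beta> c n" for n
        unfolding c_def[abs_def] coef_op_diff_smult coef_ker[OF v, symmetric] coef_ker[OF u(1), symmetric]
        by (simp add: vec_eq_iff algebra_simps)
      show "c 0 = 0"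
        using u01 low(1)[OF v] low(1)[OF u(1)] by (simp add: c_def t_def vec_eq_iff forall_2)
      show "c 1 = 0"
        using low(2)[OF v] low(2)[OF u(1)] by (simp add: c_def)
    qed
    then have "v - scaleC t u = 0"
      by (intro coef_zero_imp_zero) (simp add: coef_diff coef_scaleC c_def)
    then show ?thesis by (auto simp: l2.span_singleton)
  qed
  then show ?thesis
    using u by (intro l2.dim_unique[of "{u}"]) auto
qed

end
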